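(* Let $d\ge 1$ and $K\geq 2$ be fixed integers and let $\sigma>0$. For each $N\ge 1$ let $\{X^n_i\}_{1\leq i\leq N,\,n\ge 0}$ be the $K$-averaging model with $N$ particles in $\mathbb{R}^d$, and let $\rho^n_{\mathrm{emp}} = \frac{1}{N}\sum_{i=1}^N \delta_{X^n_i}$ be its empirical distribution at time $n$. Let $\overline{\rho}^0$ be a probability measure on $\mathbb{R}^d$ and let $\overline{\rho}^n$ be defined by $\overline{\rho}^{n+1}=T[\overline{\rho}^n]$ for $n\ge 0$. If $$\rho^0_{\mathrm{emp}} \xrightarrow{\ \mathbb{P}\ } \overline{\rho}^0 \quad\text{as } N\to\infty,$$ then for each fixed $n\in\mathbb{N}$, $$\rho^n_{\mathrm{emp}} \xrightarrow{\ \mathbb{P}\ } \overline{\rho}^n \quad\text{as } N\to\infty.$$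
   Context: $K$-averaging model: the particles $X^n_i\in\mathbb{R}^d$, $1\le i\le N$, evolve in discrete time $n=0,1,2,\dots$ by $$X^{n+1}_i = \frac{1}{K}\sum_{j=1}^K X^n_{S^n_i(j)} + W^n_i,\qquad 1\le i\le N,$$ where the indices $S^n_i(j)$ are uniformly distributed on $\{1,\dots,N\}$, the noises $W^n_i$ have law $\mathcal{N}(\bm{0},\sigma^2\mathbb{I}_d)$ ($\mathbb{I}_d$ the $d\times d$ identity matrix), and all the $S^n_i(j)$ and $W^n_i$ (over all $i,j,n$) are mutually independent and independent of the initial configuration $(X^0_i)_{1\le i\le N}$. Let $\mathcal{P}(\mathbb{R}^d)$ be the set of probability measures on $\mathbb{R}^d$. The operator $T:\mathcal{P}(\mathbb{R}^d)\to\mathcal{P}(\mathbb{R}^d)$ is $T[\rho]=\phi*S_K[C_K[\rho]]$, where $\phi$ is the density of $\mathcal{N}(\bm{0},\sigma^2\mathbb{I}_d)$, $C_K[\rho]=\rho*\cdots*\rho$ ($K$ times), and $S_K[\rho](\bm{x})=K^d\rho(K\bm{x})$ (for a measure: the push-forward under $\bm{x}\mapsto \bm{x}/K$). Equivalently, $T[\rho]$ is the law of $\frac1K\sum_{j=1}^K Y_j+W$ with $Y_1,\dots,Y_K$ i.i.d. of law $\rho$ and $W\sim\mathcal{N}(\bm{0},\sigma^2\mathbb{I}_d)$ independent of them. For random probability measures $\mu_N$ and $\mu\in\mathcal{P}(\mathbb{R}^d)$, $\mu_N\xrightarrow{\mathbb{P}}\mu$ means that for every bounded continuous $\varphi:\mathbb{R}^d\to\mathbb{R}$,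 the random variables $\langle\mu_N,\varphi\rangle=\int\varphi\,d\mu_N$ converge in probability to $\langle\mu,\varphi\rangle$. *)

theory Defs
  imports "HOL-Probability.Probability"
begin

text \<open>
  The law of \<open>N(0, \<sigma>\<^sup>2 I)\<close> on \<open>\<real>\<^sup>d\<close>; the parameter \<open>\<sigma>\<close> is the standard deviation of each coordinate.
\<close>

definition gaussian_density :: "real \<Rightarrow> real ^ 'd \<Rightarrow> real" where
  "gaussian_density \<sigma> x =
     exp (- (norm x)\<^sup>2 / (2 * \<sigma>\<^sup>2)) / sqrt (2 * pi * \<sigma>\<^sup>2) ^ CARD('d)"

definition gaussian :: "real \<Rightarrow> (real ^ 'd) measure" where
  "gaussian \<sigma> = density lborel (\<lambda>x. ennreal (gaussian_density \<sigma> x))"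

lemma gaussian_density_eq_prod:
  fixes x :: "real ^ 'd"
  shows "gaussian_density \<sigma> x = (\<Prod>i\<in>UNIV. normal_density 0 \<sigma> (x $ i))"
proof -
  have "(norm x)\<^sup>2 = (\<Sum>i\<in>UNIV. (x $ i)\<^sup>2)"
    by (simp add: norm_vec_def L2_set_def sum_nonneg)
  then have "exp (- (norm x)\<^sup>2 / (2 * \<sigma>\<^sup>2)) = (\<Prod>i\<in>UNIV. exp (- (x $ i)\<^sup>2 / (2 * \<sigma>\<^sup>2)))"
    by (simp add: exp_sum[symmetric] sum_divide_distrib[symmetric] sum_negf)
  then show ?thesis
    by (simp add: gaussian_density_def normal_density_def prod_dividef)
qed

lemma prob_space_gaussian:
  assumes "\<sigma> > 0"
  shows "prob_space (gaussian \<sigma> :: (real ^ 'd) measure)"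
proof
  interpret product_sigma_finite "\<lambda>_ :: real ^ 'd. lborel :: real measure" ..
  let ?g = "\<lambda>t. ennreal (normal_density 0 \<sigma> t)"
  have [measurable]: "(gaussian_density \<sigma> :: real ^ 'd \<Rightarrow> real) \<in> borel_measurable borel"
    unfolding gaussian_density_def by measurable
  have one: "(\<integral>\<^sup>+t. ?g t \<partial>lborel) = 1"
    using prob_space.emeasure_space_1[OF prob_space_normal_density[OF assms, of 0]]
    by (simp add: emeasure_density)
  have prod: "ennreal (gaussian_density \<sigma> x) = (\<Prod>b\<in>Basis. ?g (x \<bullet> b))" for x :: "real ^ 'd"
  proof -
    have B: "(Basis :: (real ^ 'd) set) = (\<lambda>i. axis i 1) ` UNIV" "inj (\<lambda>i :: 'd. axis i (1::real))"
      by (auto simp: Basis_vec_def inj_on_def axis_eq_axis)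
    show ?thesis
      using B(2) by (simp add: gaussian_density_eq_prod B(1) prod.reindex inner_axis prod_ennreal)
  qed
  have "emeasure (gaussian \<sigma>) (space (gaussian \<sigma> :: (real ^ 'd) measure)) =
      (\<integral>\<^sup>+x. gaussian_density \<sigma> (x :: real ^ 'd) \<partial>lborel)"
    by (simp add: gaussian_def emeasure_density)
  also have "\<dots> = (\<integral>\<^sup>+f. gaussian_density \<sigma> (\<Sum>b\<in>Basis. f b *\<^sub>R (b :: real ^ 'd)) \<partial>(\<Pi>\<^sub>M b\<in>Basis. lborel))"
    by (subst lborel_eq, subst nn_integral_distr) simp_all
  also have "\<dots> = (\<integral>\<^sup>+f. (\<Prod>b\<in>(Basis :: (real ^ 'd) set). ?g (f b)) \<partial>(\<Pi>\<^sub>M b\<in>Basis. lborel))"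
    by (intro nn_integral_cong) (simp add: prod inner_sum_left inner_Basis if_distrib sum.delta cong: if_cong)
  also have "\<dots> = 1"
    by (subst product_nn_integral_prod) (simp_all add: one)
  finally show "emeasure (gaussian \<sigma>) (space (gaussian \<sigma> :: (real ^ 'd) measure)) = 1" .
qed

primrec conv_power :: "nat \<Rightarrow> (real ^ 'd) measure \<Rightarrow> (real ^ 'd) measure" where
  "conv_power 0 \<rho> = return borel 0"
| "conv_power (Suc k) \<rho> = (\<rho> \<star> conv_power k \<rho>)"

definition scale_down :: "nat \<Rightarrow> (real ^ 'd) measure \<Rightarrow> (real ^ 'd) measure" where
  "scale_down K \<rho> = distr \<rho> borel (\<lambda>x. x /\<^sub>R real K)"

definition averaging_operator :: "nat \<Rightarrow> real \<Rightarrow> (real ^ 'd) measure \<Rightarrow> (real ^ 'd) measure" where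
  "averaging_operator K \<sigma> \<rho> = (gaussian \<sigma> \<star> scale_down K (conv_power K \<rho>))"

lemma prob_space_convolution:
  assumes "prob_space \<mu>" "prob_space \<nu>" "sets \<mu> = sets borel" "sets \<nu> = sets borel"
  shows "prob_space (\<mu> \<star> \<nu>)"
proof -
  note [measurable_cong] = assms(3,4)
  interpret prob_space \<mu> by fact
  interpret \<nu>: prob_space \<nu> by fact
  interpret pair_prob_space \<mu> \<nu> ..
  show ?thesis
    unfolding convolution_def by (rule P.prob_space_distr) measurable
qed

lemma sets_conv_power [simp]: "sets (conv_power k \<rho>) = sets borel"
  by (cases k) simp_all

lemma prob_space_conv_power:
  "prob_space \<rho> \<Longrightarrow> sets \<rho> = sets borel \<Longrightarrow> prob_space (conv_power k \<rho>)"
  by (induction k) (auto intro: prob_space_return prob_space_convolution)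

lemma sets_averaging_operator [simp]: "sets (averaging_operator K \<sigma> \<rho>) = sets borel"
  by (simp add: averaging_operator_def)

lemma prob_space_averaging_operator:
  assumes "\<sigma> > 0" "prob_space \<rho>" "sets \<rho> = sets borel"
  shows "prob_space (averaging_operator K \<sigma> \<rho>)"
proof -
  have "(\<lambda>x. x /\<^sub>R real K) \<in> conv_power K \<rho> \<rightarrow>\<^sub>M borel"
    by (subst measurable_cong_sets[OF sets_conv_power refl]) simp
  then have "prob_space (scale_down K (conv_power K \<rho>))"
    unfolding scale_down_def
    by (rule prob_space.prob_space_distr[OF prob_space_conv_power[OF assms(2,3)]])
  then show ?thesis
    unfolding averaging_operator_def
    by (intro prob_space_convolution prob_space_gaussian assms)
      (simp_all add: gaussian_def scale_down_def)
qed

text \<open>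
  The sources of randomness take values in different spaces (configurations, indices, vectors),
  so their mutual independence is expressed through the \<sigma>-algebras they generate.
  The initial configuration is a single source: its components may be dependent.
\<close>

datatype source = Initial | Index nat nat nat | Noise nat nat

fun source_algebra ::
    "'a measure \<Rightarrow> nat \<Rightarrow> (nat \<Rightarrow> nat \<Rightarrow> 'a \<Rightarrow> real ^ 'd) \<Rightarrow> (nat \<Rightarrow> nat \<Rightarrow> nat \<Rightarrow> 'a \<Rightarrow> nat)
      \<Rightarrow> (nat \<Rightarrow> nat \<Rightarrow> 'a \<Rightarrow> real ^ 'd) \<Rightarrow> source \<Rightarrow> 'a set set" where
  "source_algebra M N X S W Initial =
     sets (vimage_algebra (space M) (\<lambda>\<omega>. \<lambda>i\<in>{1..N}. X 0 i \<omega>) (\<Pi>\<^sub>M i\<in>{1..N}. borel))"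
| "source_algebra M N X S W (Index n i j) =
     sets (vimage_algebra (space M) (S n i j) (count_space {1..N}))"
| "source_algebra M N X S W (Noise n i) = sets (vimage_algebra (space M) (W n i) borel)"

definition sources :: "nat \<Rightarrow> nat \<Rightarrow> source set" where
  "sources N K = {Initial} \<union> {Index n i j | n i j. i \<in> {1..N} \<and> j \<in> {1..K}}
     \<union> {Noise n i | n i. i \<in> {1..N}}"

text \<open>In \<open>X n i\<close>, \<open>S n i j\<close> and \<open>W n i\<close>, the argument \<open>n\<close> is the time and \<open>i\<close> the particle.\<close>

locale K_averaging_model = prob_space M
  for M :: "'a measure" +
  fixes K :: nat and \<sigma> :: real and N :: nat
    and X :: "nat \<Rightarrow> nat \<Rightarrow> 'a \<Rightarrow> real ^ 'd"
    and S :: "nat \<Rightarrow> nat \<Rightarrow> nat \<Rightarrow> 'a \<Rightarrow> nat"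
    and W :: "nat \<Rightarrow> nat \<Rightarrow> 'a \<Rightarrow> real ^ 'd"
  assumes initial_rv: "i \<in> {1..N} \<Longrightarrow> random_variable borel (X 0 i)"
    and index_rv: "i \<in> {1..N} \<Longrightarrow> j \<in> {1..K} \<Longrightarrow> random_variable (count_space {1..N}) (S n i j)"
    and noise_rv: "i \<in> {1..N} \<Longrightarrow> random_variable borel (W n i)"
    and index_law: "i \<in> {1..N} \<Longrightarrow> j \<in> {1..K} \<Longrightarrow>
      distr M (count_space {1..N}) (S n i j) = uniform_count_measure {1..N}"
    and noise_law: "i \<in> {1..N} \<Longrightarrow> distr M borel (W n i) = gaussian \<sigma>"
    and independent: "indep_sets (source_algebra M N X S W) (sources N K)"
    and step: "i \<in> {1..N} \<Longrightarrow> \<omega> \<in> space M \<Longrightarrow>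
      X (Suc n) i \<omega> = (1 / real K) *\<^sub>R (\<Sum>j = 1..K. X n (S n i j \<omega>) \<omega>) + W n i \<omega>"
begin

lemma random_variable_position:
  "i \<in> {1..N} \<Longrightarrow> random_variable borel (X n i)"
proof (induction n arbitrary: i)
  case 0
  then show ?case by (rule initial_rv)
next
  case (Suc n)
  have "random_variable borel (\<lambda>\<omega>. X n (S n i j \<omega>) \<omega>)" if "j \<in> {1..K}" for j
    by (rule measurable_compose_countable'[where I = "{1..N}"])
      (use Suc that index_rv in auto)
  then have "random_variable borel
      (\<lambda>\<omega>. (1 / real K) *\<^sub>R (\<Sum>j = 1..K. X n (S n i j \<omega>) \<omega>) + W n i \<omega>)"
    using noise_rv[OF Suc.prems]
    by (intro borel_measurable_add borel_measurable_scaleR borel_measurable_sum) auto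
  then show ?case
    by (subst measurable_cong[OF step[OF Suc.prems]]) auto
qed

end

definition empirical_measure :: "nat \<Rightarrow> (nat \<Rightarrow> real ^ 'd) \<Rightarrow> (real ^ 'd) measure" where
  "empirical_measure N x = measure_of UNIV (sets borel)
     (\<lambda>A. ennreal (1 / real N) * (\<Sum>i = 1..N. emeasure (return borel (x i)) A))"

lemma sets_empirical_measure [simp, measurable_cong]: "sets (empirical_measure N x) = sets borel"
  using sets.sigma_sets_eq[of borel] by (simp add: empirical_measure_def)

lemma space_empirical_measure [simp]: "space (empirical_measure N x) = UNIV"
  using sets_eq_imp_space_eq[OF sets_empirical_measure] by simp

lemma emeasure_empirical_measure:
  fixes x :: "nat \<Rightarrow> real ^ 'd"
  assumes "A \<in> sets borel"
  shows "emeasure (empirical_measure N x) A =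
    ennreal (1 / real N) * (\<Sum>i = 1..N. emeasure (return borel (x i)) A)"
proof (rule emeasure_measure_of[OF empirical_measure_def])
  show "countably_additive (sets (empirical_measure N x))
      (\<lambda>A. ennreal (1 / real N) * (\<Sum>i = 1..N. emeasure (return borel (x i)) A))"
  proof (rule countably_additiveI)
    fix F :: "nat \<Rightarrow> (real ^ 'd) set"
    assume "range F \<subseteq> sets (empirical_measure N x)" "disjoint_family F"
    then have "(\<Sum>k. emeasure (return borel (x i)) (F k)) =
        emeasure (return borel (x i)) (\<Union>k. F k)" for i
      by (intro suminf_emeasure) auto
    then show "(\<Sum>k. ennreal (1 / real N) * (\<Sum>i = 1..N. emeasure (return borel (x i)) (F k))) =
        ennreal (1 / real N) * (\<Sum>i = 1..N. emeasure (return borel (x i)) (\<Union>k. F k))"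
      by (simp add: suminf_sum)
  qed
qed (use assms in \<open>auto simp: positive_def\<close>)

text \<open>
  The \<open>N\<close>-th random object lives on its own probability space \<open>M N\<close>.  In the definition
  below \<open>Z N\<close> has to be measurable for the probabilities to be meaningful; for integrals against
  the empirical measures of the model this follows from \<open>random_variable_position\<close>.
\<close>

definition tendsto_in_prob ::
    "(nat \<Rightarrow> 'a measure) \<Rightarrow> (nat \<Rightarrow> 'a \<Rightarrow> real) \<Rightarrow> real \<Rightarrow> bool" where
  "tendsto_in_prob M Z c \<longleftrightarrow>
     (\<forall>\<epsilon>>0. (\<lambda>N. measure (M N) {\<omega> \<in> space (M N). \<epsilon> < \<bar>Z N \<omega> - c\<bar>}) \<longlonglongrightarrow> 0)"

definition tendsto_weakly_in_prob ::
    "(nat \<Rightarrow> 'a measure) \<Rightarrow> (nat \<Rightarrow> 'a \<Rightarrow> (real ^ 'd) measure) \<Rightarrow> (real ^ 'd) measure \<Rightarrow> bool" where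
  "tendsto_weakly_in_prob M \<mu> \<nu> \<longleftrightarrow>
     (\<forall>\<phi> :: real ^ 'd \<Rightarrow> real. continuous_on UNIV \<phi> \<longrightarrow> bounded (range \<phi>) \<longrightarrow>
        tendsto_in_prob M (\<lambda>N \<omega>. \<integral>x. \<phi> x \<partial>\<mu> N \<omega>) (\<integral>x. \<phi> x \<partial>\<nu>))"

end

theory Submission
  imports Defs
begin

text \<open>
  The proof is by induction on the time \<open>n\<close>.  Write \<open>\<mu>\<close> for the empirical measure of the \<open>N\<close> particles at
  time \<open>n\<close> and \<open>T\<close> for the averaging operator.  Two facts carry the induction step.

  \<^item> Conditionally on the positions at time \<open>n\<close>, the positions at time \<open>n + 1\<close> are independent with
    common law \<open>T \<mu>\<close> (\<open>distr_next_position\<close>).  Hence, for a test function bounded by \<open>B\<close>, the deviation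
    of the next empirical average from \<open>\<langle>T \<mu>, \<phi>\<rangle>\<close> is a mean of \<open>N\<close> orthogonal terms bounded by
    \<open>2 B\<close>, and its second moment is at most \<open>(2 B)\<^sup>2 / N\<close>
    (\<open>second_moment_empirical_measure_Suc\<close>).  By Chebyshev's inequality it tends to \<open>0\<close> in probability.
  \<^item> \<open>T\<close> is continuous for weak convergence (\<open>tendsto_weakly_averaging_operator\<close>), because convolution is
    (\<open>tendsto_weakly_convolution\<close>).  So \<open>\<langle>T \<mu>, \<phi>\<rangle>\<close> tends to \<open>\<langle>T (\<rho> n), \<phi>\<rangle>\<close>
    in probability when \<open>\<mu>\<close> tends to \<open>\<rho> n\<close>.

  The second fact has to be applied to random measures, which for different \<open>N\<close> live on unrelated
  probability spaces, so that passing to an almost surely convergent subsequence would first require a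
  coupling.  Instead, convergence in probability is recognised as ordinary convergence along the filter
  \<open>high_probability M\<close> on the pairs \<open>(N, \<omega>)\<close> (\<open>tendsto_in_prob_iff_high_probability\<close>), and
  the continuity of \<open>T\<close> is proved along an arbitrary filter: it is a deterministic statement whose proof
  tests the measures against finitely many functions at a time.
\<close>

section \<open>Weak convergence along a filter\<close>

definition tendsto_weakly :: "('b \<Rightarrow> 'c::topological_space measure) \<Rightarrow> 'c measure \<Rightarrow> 'b filter \<Rightarrow> bool" where
  "tendsto_weakly \<mu> \<nu> F \<longleftrightarrow>
     (\<forall>\<phi> :: 'c \<Rightarrow> real. continuous_on UNIV \<phi> \<longrightarrow> bounded (range \<phi>) \<longrightarrow>
        ((\<lambda>a. \<integral>x. \<phi> x \<partial>\<mu> a) \<longlongrightarrow> (\<integral>x. \<phi> x \<partial>\<nu>)) F)"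

lemma tendsto_weaklyD:
  fixes \<phi> :: "'c::topological_space \<Rightarrow> real"
  assumes "tendsto_weakly \<mu> \<nu> F" "continuous_on UNIV \<phi>" "\<And>x. \<bar>\<phi> x\<bar> \<le> B"
  shows "((\<lambda>a. \<integral>x. \<phi> x \<partial>\<mu> a) \<longlongrightarrow> (\<integral>x. \<phi> x \<partial>\<nu>)) F"
proof -
  have "bounded (range \<phi>)"
    using assms(3) by (auto simp: bounded_iff)
  then show ?thesis
    using assms(1,2) unfolding tendsto_weakly_def by blast
qed

lemma tendsto_weaklyI:
  fixes \<mu> :: "'b \<Rightarrow> 'c::topological_space measure"
  assumes "\<And>(\<phi> :: 'c \<Rightarrow> real) B. continuous_on UNIV \<phi> \<Longrightarrow> (\<And>x. \<bar>\<phi> x\<bar> \<le> B) \<Longrightarrow>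
    ((\<lambda>a. \<integral>x. \<phi> x \<partial>\<mu> a) \<longlongrightarrow> (\<integral>x. \<phi> x \<partial>\<nu>)) F"
  shows "tendsto_weakly \<mu> \<nu> F"
  unfolding tendsto_weakly_def
proof safe
  fix \<phi> :: "'c \<Rightarrow> real"
  assume \<phi>: "continuous_on UNIV \<phi>" "bounded (range \<phi>)"
  from \<phi>(2) obtain B where B: "\<And>x. \<bar>\<phi> x\<bar> \<le> B"
    by (auto simp: bounded_iff)
  show "((\<lambda>a. \<integral>x. \<phi> x \<partial>\<mu> a) \<longlongrightarrow> (\<integral>x. \<phi> x \<partial>\<nu>)) F"
    by (rule assms[of \<phi> B]) (use \<phi>(1) B in auto)
qed

lemma integrable_bounded_borel:
  fixes f :: "'c::topological_space \<Rightarrow> real"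
  assumes "prob_space M" and M: "sets M = sets borel" and f: "f \<in> borel_measurable borel" "\<And>x. \<bar>f x\<bar> \<le> B"
  shows "integrable M f"
proof -
  interpret prob_space M by fact
  have "f \<in> borel_measurable M"
    using f(1) by (subst measurable_cong_sets[OF M refl])
  then show ?thesis
    by (rule integrable_const_bound[where B = B, rotated]) (use f(2) in auto)
qed

lemma abs_integral_le:
  fixes f :: "'c::topological_space \<Rightarrow> real"
  assumes M: "prob_space M" "sets M = sets borel" and f: "f \<in> borel_measurable borel" "\<And>x. \<bar>f x\<bar> \<le> B"
  shows "\<bar>\<integral>x. f x \<partial>M\<bar> \<le> B"
proof -
  interpret prob_space M by fact
  have "\<bar>\<integral>x. f x \<partial>M\<bar> \<le> (\<integral>x. \<bar>f x\<bar> \<partial>M)"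
    by (rule integral_abs_bound)
  also have "\<dots> \<le> B"
    by (rule integral_le_const) (use f integrable_bounded_borel[OF M f] in auto)
  finally show ?thesis .
qed

lemma integral_convolution:
  fixes h :: "'c::ordered_euclidean_space \<Rightarrow> real"
  assumes "prob_space \<mu>" "prob_space \<nu>"
    and [measurable_cong]: "sets \<mu> = sets borel" "sets \<nu> = sets borel"
    and [measurable]: "h \<in> borel_measurable borel" and B: "\<And>x. \<bar>h x\<bar> \<le> B"
  shows "(\<integral>z. h z \<partial>(\<mu> \<star> \<nu>)) = (\<integral>x. \<integral>y. h (x + y) \<partial>\<nu> \<partial>\<mu>)"
proof -
  interpret \<mu>: prob_space \<mu> by fact
  interpret \<nu>: prob_space \<nu> by fact
  interpret pair_prob_space \<mu> \<nu> ..
  have "(\<integral>z. h z \<partial>(\<mu> \<star> \<nu>)) = (\<integral>p. h (fst p + snd p) \<partial>(\<mu> \<Otimes>\<^sub>M \<nu>))"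
    unfolding convolution_def by (subst integral_distr) (simp_all add: case_prod_beta)
  also have "\<dots> = (\<integral>x. \<integral>y. h (x + y) \<partial>\<nu> \<partial>\<mu>)"
  proof (subst integral_fst'[symmetric])
    show "integrable (\<mu> \<Otimes>\<^sub>M \<nu>) (\<lambda>p. h (fst p + snd p))"
      by (rule P.integrable_const_bound[where B = B]) (use B in auto)
  qed simp
  finally show ?thesis .
qed

lemma continuous_on_integral_shift:
  fixes h :: "'c::euclidean_space \<Rightarrow> real"
  assumes "prob_space M" and M: "sets M = sets borel"
    and h: "continuous_on UNIV h" "\<And>x. \<bar>h x\<bar> \<le> B"
  shows "continuous_on UNIV (\<lambda>x. \<integral>y. h (x + y) \<partial>M)"
  unfolding continuous_on_sequentially comp_def
proof safe
  interpret prob_space M by fact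
  note [measurable_cong] = M
  have [measurable]: "h \<in> borel_measurable borel"
    using h(1) by (rule borel_measurable_continuous_onI)
  fix x :: 'c and s :: "nat \<Rightarrow> 'c"
  assume s: "s \<longlonglongrightarrow> x"
  show "(\<lambda>k. \<integral>y. h (s k + y) \<partial>M) \<longlonglongrightarrow> (\<integral>y. h (x + y) \<partial>M)"
  proof (rule integral_dominated_convergence[where w = "\<lambda>_. B"])
    have "(\<lambda>k. h (s k + y)) \<longlonglongrightarrow> h (x + y)" for y
      by (rule continuous_on_tendsto_compose[OF h(1)]) (auto intro!: tendsto_intros s)
    then show "AE y in M. (\<lambda>k. h (s k + y)) \<longlonglongrightarrow> h (x + y)" by simp
  qed (use h(2) in auto)
qed

text \<open>
  A continuous replacement for the indicator of the complement of a ball.  Being a test function for weak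
  convergence, it transfers tightness from the limit to the approximating measures.
\<close>

definition tail_cutoff :: "real \<Rightarrow> 'c::real_normed_vector \<Rightarrow> real" where
  "tail_cutoff R x = min 1 (max 0 (norm x - R))"

lemma tail_cutoff_bounds: "0 \<le> tail_cutoff R x" "tail_cutoff R x \<le> 1" "\<bar>tail_cutoff R x\<bar> \<le> 1"
  by (auto simp: tail_cutoff_def)

lemma continuous_tail_cutoff: "continuous_on UNIV (tail_cutoff R)"
  unfolding tail_cutoff_def by (intro continuous_intros)

lemma borel_tail_cutoff [measurable]: "tail_cutoff R \<in> borel_measurable borel"
  using continuous_tail_cutoff by (rule borel_measurable_continuous_onI)

lemma tail_cutoff_eq_1: "norm x > R + 1 \<Longrightarrow> tail_cutoff R x = 1"
  by (auto simp: tail_cutoff_def)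

lemma tendsto_tail_cutoff:
  fixes M :: "'c::euclidean_space measure"
  assumes "prob_space M" and [measurable_cong]: "sets M = sets borel"
  shows "(\<lambda>k. \<integral>x. tail_cutoff (real k) x \<partial>M) \<longlonglongrightarrow> 0"
proof -
  interpret prob_space M by fact
  have "(\<lambda>k. \<integral>x. tail_cutoff (real k) x \<partial>M) \<longlonglongrightarrow> (\<integral>x. 0 \<partial>M)"
  proof (rule integral_dominated_convergence[where w = "\<lambda>_. 1"])
    have "(\<lambda>k. tail_cutoff (real k) x) \<longlonglongrightarrow> 0" for x :: 'c
    proof (rule tendsto_eventually)
      show "\<forall>\<^sub>F k in sequentially. tail_cutoff (real k) x = 0"
        using eventually_ge_at_top[of "nat \<lceil>norm x\<rceil>"]
        by eventually_elim (auto simp: tail_cutoff_def)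
    qed
    then show "AE x in M. (\<lambda>k. tail_cutoff (real k) x) \<longlonglongrightarrow> 0" by simp
  qed (auto simp: tail_cutoff_bounds)
  then show ?thesis by simp
qed

text \<open>
  For \<open>h\<close> bounded by \<open>B\<close>, put \<open>H \<nu>' x = \<integral>y. h (x + y) \<partial>\<nu>'\<close>, so that
  \<open>\<langle>\<mu> \<star> \<nu>, h\<rangle> = \<langle>\<mu>, H \<nu>\<rangle>\<close>.  As \<open>H \<nu>0\<close> is a legitimate test function for
  \<open>\<mu>\<close>, only \<open>\<langle>\<mu> a, H (\<nu> a) - H \<nu>0\<rangle>\<close> needs work.  There \<open>H (\<nu> a)\<close> converges to \<open>H \<nu>0\<close>
  pointwise; since \<open>h\<close> is uniformly continuous on balls and the \<open>\<nu> a\<close> have small tails,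
  the functions \<open>H (\<nu> a)\<close> are equicontinuous up to a small error on each ball, so convergence on a finite
  net gives uniform convergence on the ball, and the tail of \<open>\<mu> a\<close> accounts for the rest.

  The hypotheses are confined to a set \<open>D\<close> of indices that is eventually reached, because
  there is no empirical probability measure of \<open>N = 0\<close> particles.
\<close>

lemma tendsto_weakly_convolution:
  fixes \<mu> \<nu> :: "'b \<Rightarrow> 'c::ordered_euclidean_space measure"
  assumes prob: "\<And>a. a \<in> D \<Longrightarrow> prob_space (\<mu> a)" "\<And>a. a \<in> D \<Longrightarrow> prob_space (\<nu> a)" "prob_space \<mu>0" "prob_space \<nu>0"
    and sets: "\<And>a. a \<in> D \<Longrightarrow> sets (\<mu> a) = sets borel" "\<And>a. a \<in> D \<Longrightarrow> sets (\<nu> a) = sets borel"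
      "sets \<mu>0 = sets borel" "sets \<nu>0 = sets borel"
    and D: "\<forall>\<^sub>F a in F. a \<in> D"
    and \<mu>: "tendsto_weakly \<mu> \<mu>0 F" and \<nu>: "tendsto_weakly \<nu> \<nu>0 F"
  shows "tendsto_weakly (\<lambda>a. \<mu> a \<star> \<nu> a) (\<mu>0 \<star> \<nu>0) F"
proof (rule tendsto_weaklyI)
  fix h :: "'c \<Rightarrow> real" and B
  assume h: "continuous_on UNIV h" and B: "\<And>x. \<bar>h x\<bar> \<le> B"
  have B0: "0 \<le> B" using B[of 0] by linarith
  note cond = prob sets
  have hm [measurable]: "h \<in> borel_measurable borel"
    using h by (rule borel_measurable_continuous_onI)
  define H where "H = (\<lambda>\<nu> x. \<integral>y. h (x + y) \<partial>\<nu>)"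
  have H_cont: "continuous_on UNIV (H \<nu>')" if "prob_space \<nu>'" "sets \<nu>' = sets borel" for \<nu>'
    unfolding H_def by (rule continuous_on_integral_shift[OF that h B])
  have H_bound: "\<bar>H \<nu>' x\<bar> \<le> B" if "prob_space \<nu>'" "sets \<nu>' = sets borel" for \<nu>' x
    unfolding H_def by (rule abs_integral_le[OF that]) (use B in auto)
  have conv: "(\<integral>z. h z \<partial>(\<mu>' \<star> \<nu>')) = (\<integral>x. H \<nu>' x \<partial>\<mu>')"
    if "prob_space \<mu>'" "sets \<mu>' = sets borel" "prob_space \<nu>'" "sets \<nu>' = sets borel" for \<mu>' \<nu>'
    unfolding H_def by (rule integral_convolution) (use that B in auto)

  have main: "\<forall>\<^sub>F a in F. \<bar>(\<integral>x. H (\<nu> a) x \<partial>\<mu> a) - (\<integral>x. H \<nu>0 x \<partial>\<mu> a)\<bar> \<le> (3 + 6 * B) * e"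
    if e: "e > 0" for e
  proof -
    have "\<forall>\<^sub>F k in sequentially. (\<integral>x. tail_cutoff (real k) x \<partial>\<mu>0) < e \<and> (\<integral>x. tail_cutoff (real k) x \<partial>\<nu>0) < e"
      using order_tendstoD(2)[OF tendsto_tail_cutoff[OF prob(3) sets(3)] e]
        order_tendstoD(2)[OF tendsto_tail_cutoff[OF prob(4) sets(4)] e]
      by eventually_elim auto
    then obtain k :: nat where k: "(\<integral>x. tail_cutoff (real k) x \<partial>\<mu>0) < e" "(\<integral>x. tail_cutoff (real k) x \<partial>\<nu>0) < e"
      using eventually_happens[of _ sequentially] by (auto simp: trivial_limit_sequentially)
    define R where "R = real k"
    let ?\<chi> = "tail_cutoff R :: 'c \<Rightarrow> real"
    \<comment> \<open>The cutoff equals 1 only beyond radius \<open>R + 1\<close>, so both summands are confined to that radius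
      and their sum to twice that radius.\<close>
    have "uniformly_continuous_on (cball 0 (2 * (R + 1))) h"
      using compact_uniformly_continuous[OF continuous_on_subset[OF h]] by auto
    then obtain d where d: "d > 0" and unif:
      "\<And>x x'. x \<in> cball 0 (2 * (R + 1)) \<Longrightarrow> x' \<in> cball 0 (2 * (R + 1)) \<Longrightarrow> dist x' x < d \<Longrightarrow> dist (h x') (h x) < e"
      using uniformly_continuous_onE[OF _ e] by blast
    have "cball (0::'c) (R + 1) \<subseteq> (\<Union>z\<in>cball 0 (R + 1). ball z d)"
      using d by force
    then obtain Z where Z: "Z \<subseteq> cball (0::'c) (R + 1)" "finite Z" "cball 0 (R + 1) \<subseteq> (\<Union>z\<in>Z. ball z d)"
      by (rule compactE_image[OF compact_cball[of 0 "R + 1"], rotated]) auto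
    have equi: "\<bar>H \<nu>' x - H \<nu>' z\<bar> \<le> e + 2 * B * (\<integral>y. ?\<chi> y \<partial>\<nu>')"
      if \<nu>': "prob_space \<nu>'" "sets \<nu>' = sets borel"
        and x: "norm x \<le> R + 1" "norm z \<le> R + 1" "dist z x < d" for \<nu>' x z
    proof -
      interpret prob_space \<nu>' by fact
      note int = integrable_bounded_borel[OF \<nu>']
      have i [simp]: "integrable \<nu>' (\<lambda>y. h (x + y))" "integrable \<nu>' (\<lambda>y. h (z + y))" "integrable \<nu>' ?\<chi>"
        by (rule int[where B = B], simp, rule B) (rule int[where B = B], simp, rule B,
          rule int[where B = 1], simp, rule tail_cutoff_bounds)
      have pw: "\<bar>h (x + y) - h (z + y)\<bar> \<le> e + 2 * B * ?\<chi> y" for y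
      proof (cases "norm y \<le> R + 1")
        case True
        have "norm (x + y) \<le> 2 * (R + 1)" "norm (z + y) \<le> 2 * (R + 1)"
          using x True norm_triangle_ineq[of x y] norm_triangle_ineq[of z y] by auto
        then have "\<bar>h (x + y) - h (z + y)\<bar> < e"
          using unif[of "z + y" "x + y"] x(3) by (simp add: dist_real_def dist_commute)
        then show ?thesis
          using B0 tail_cutoff_bounds(1)[of R y] by (smt (verit) mult_nonneg_nonneg)
      next
        case False
        then show ?thesis
          using B[of "x + y"] B[of "z + y"] e by (simp add: tail_cutoff_eq_1 abs_le_iff)
      qed
      have "\<bar>H \<nu>' x - H \<nu>' z\<bar> = \<bar>\<integral>y. h (x + y) - h (z + y) \<partial>\<nu>'\<bar>"
        unfolding H_def by simp
      also have "\<dots> \<le> (\<integral>y. \<bar>h (x + y) - h (z + y)\<bar> \<partial>\<nu>')"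
        by (rule integral_abs_bound)
      also have "\<dots> \<le> (\<integral>y. e + 2 * B * ?\<chi> y \<partial>\<nu>')"
        by (intro integral_mono) (use pw in auto)
      also have "\<dots> = e + 2 * B * (\<integral>y. ?\<chi> y \<partial>\<nu>')"
        by (simp add: prob_space)
      finally show ?thesis .
    qed
    have ev1: "\<forall>\<^sub>F a in F. \<forall>z\<in>Z. \<bar>H (\<nu> a) z - H \<nu>0 z\<bar> < e"
      unfolding eventually_ball_finite_distrib[OF Z(2)]
    proof
      fix z
      have "continuous_on UNIV (\<lambda>y. h (z + y))"
        by (rule continuous_on_compose2[OF h]) (auto intro!: continuous_intros)
      then have "((\<lambda>a. H (\<nu> a) z) \<longlongrightarrow> H \<nu>0 z) F"
        unfolding H_def by (rule tendsto_weaklyD[OF \<nu>]) (rule B)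
      then show "\<forall>\<^sub>F a in F. \<bar>H (\<nu> a) z - H \<nu>0 z\<bar> < e"
        using tendstoD[OF _ e, of "\<lambda>a. H (\<nu> a) z"] by (simp add: dist_real_def)
    qed
    have ev2: "\<forall>\<^sub>F a in F. (\<integral>x. ?\<chi> x \<partial>\<mu> a) < e" "\<forall>\<^sub>F a in F. (\<integral>x. ?\<chi> x \<partial>\<nu> a) < e"
      using order_tendstoD(2)[OF tendsto_weaklyD[OF \<mu> continuous_tail_cutoff tail_cutoff_bounds(3)]]
        order_tendstoD(2)[OF tendsto_weaklyD[OF \<nu> continuous_tail_cutoff tail_cutoff_bounds(3)]]
        k by (auto simp: R_def)
    show ?thesis
      using ev1 ev2 D
    proof eventually_elim
      case (elim a)
      interpret \<mu>: prob_space "\<mu> a" using elim prob by auto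
      have s: "sets (\<mu> a) = sets borel" "sets (\<nu> a) = sets borel" "prob_space (\<nu> a)"
        using elim sets prob by auto
      note int = integrable_bounded_borel[OF \<mu>.prob_space_axioms s(1)]
      have mH [measurable]: "H (\<nu> a) \<in> borel_measurable borel" "H \<nu>0 \<in> borel_measurable borel"
        by (intro borel_measurable_continuous_onI H_cont cond s)+
      have i [simp]: "integrable (\<mu> a) (H (\<nu> a))" "integrable (\<mu> a) (H \<nu>0)" "integrable (\<mu> a) ?\<chi>"
        by (rule int[OF mH(1) H_bound[OF s(3,2)]], rule int[OF mH(2) H_bound[OF prob(4) sets(4)]],
          rule int[OF borel_tail_cutoff tail_cutoff_bounds(3)])
      have pw: "\<bar>H (\<nu> a) x - H \<nu>0 x\<bar> \<le> (3 + 4 * B) * e + 2 * B * ?\<chi> x" for x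
      proof (cases "norm x \<le> R + 1")
        case True
        then obtain z where z: "z \<in> Z" "dist z x < d" "norm z \<le> R + 1"
          using Z by (force simp: subset_eq)
        have "\<bar>H (\<nu> a) x - H (\<nu> a) z\<bar> \<le> e + 2 * B * e"
          using equi[OF s(3,2) True z(3,2)] elim(3) B0 mult_left_mono[of "\<integral>x. ?\<chi> x \<partial>\<nu> a" e "2 * B"] by auto
        moreover have "\<bar>H \<nu>0 x - H \<nu>0 z\<bar> \<le> e + 2 * B * e"
          using equi[OF prob(4) sets(4) True z(3,2)] k(2) B0 mult_left_mono[of "\<integral>x. ?\<chi> x \<partial>\<nu>0" e "2 * B"]
          by (auto simp: R_def)
        moreover have "\<bar>H (\<nu> a) z - H \<nu>0 z\<bar> < e"
          using elim(1) z(1) by blast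
        ultimately have "\<bar>H (\<nu> a) x - H \<nu>0 x\<bar> \<le> (3 + 4 * B) * e"
          by (simp add: algebra_simps)
        then show ?thesis
          using B0 tail_cutoff_bounds(1)[of R x] by (smt (verit) mult_nonneg_nonneg)
      next
        case False
        have "0 \<le> (3 + 4 * B) * e" using B0 e by auto
        then show ?thesis
          using H_bound[OF s(3,2), of x] H_bound[OF prob(4) sets(4), of x] False
          by (simp add: tail_cutoff_eq_1 abs_le_iff)
      qed
      have "\<bar>(\<integral>x. H (\<nu> a) x \<partial>\<mu> a) - (\<integral>x. H \<nu>0 x \<partial>\<mu> a)\<bar> = \<bar>\<integral>x. H (\<nu> a) x - H \<nu>0 x \<partial>\<mu> a\<bar>"
        by simp
      also have "\<dots> \<le> (\<integral>x. \<bar>H (\<nu> a) x - H \<nu>0 x\<bar> \<partial>\<mu> a)"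
        by (rule integral_abs_bound)
      also have "\<dots> \<le> (\<integral>x. (3 + 4 * B) * e + 2 * B * ?\<chi> x \<partial>\<mu> a)"
        by (intro integral_mono) (use pw in auto)
      also have "\<dots> = (3 + 4 * B) * e + 2 * B * (\<integral>x. ?\<chi> x \<partial>\<mu> a)"
        by (simp add: \<mu>.prob_space)
      also have "\<dots> \<le> (3 + 4 * B) * e + 2 * B * e"
        using elim(2) B0 by (intro add_left_mono mult_left_mono) auto
      finally show ?case by (simp add: algebra_simps)
    qed
  qed
  have "((\<lambda>a. (\<integral>x. H (\<nu> a) x \<partial>\<mu> a) - (\<integral>x. H \<nu>0 x \<partial>\<mu> a)) \<longlongrightarrow> 0) F"
  proof (rule tendstoI)
    fix e :: real assume e: "e > 0"
    \<comment> \<open>\<open>3\<close> counts the two equicontinuity estimates and the one at the net point; of the \<open>6 * B\<close>,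
      \<open>4 * B\<close> comes from the tails of \<open>\<nu> a\<close> and \<open>\<nu>0\<close> and \<open>2 * B\<close> from the tail of \<open>\<mu> a\<close>.\<close>
    let ?e = "e / (2 * (3 + 6 * B))"
    have p: "3 + 6 * B > 0" using B0 by simp
    then have "(3 + 6 * B) * ?e = e / 2" by (simp add: field_simps)
    then have "?e > 0" and lt: "(3 + 6 * B) * ?e < e" using e p by auto
    from main[OF this(1)] show "\<forall>\<^sub>F a in F. dist ((\<integral>x. H (\<nu> a) x \<partial>\<mu> a) - (\<integral>x. H \<nu>0 x \<partial>\<mu> a)) 0 < e"
      by eventually_elim (use lt in \<open>auto simp: dist_real_def\<close>)
  qed
  moreover have "((\<lambda>a. \<integral>x. H \<nu>0 x \<partial>\<mu> a) \<longlongrightarrow> (\<integral>x. H \<nu>0 x \<partial>\<mu>0)) F"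
    by (rule tendsto_weaklyD[OF \<mu>]) (auto intro!: H_cont H_bound cond)
  ultimately have "((\<lambda>a. \<integral>x. H (\<nu> a) x \<partial>\<mu> a) \<longlongrightarrow> (\<integral>x. H \<nu>0 x \<partial>\<mu>0)) F"
    using tendsto_add by fastforce
  moreover have "\<forall>\<^sub>F a in F. (\<integral>x. H (\<nu> a) x \<partial>\<mu> a) = (\<integral>z. h z \<partial>(\<mu> a \<star> \<nu> a))"
    using D by eventually_elim (rule conv[symmetric], simp_all add: cond)
  ultimately show "((\<lambda>a. \<integral>z. h z \<partial>(\<mu> a \<star> \<nu> a)) \<longlongrightarrow> (\<integral>z. h z \<partial>(\<mu>0 \<star> \<nu>0))) F"
    by (simp add: conv[OF prob(3) sets(3) prob(4) sets(4)] tendsto_cong)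
qed

lemma tendsto_weakly_const: "tendsto_weakly (\<lambda>_. \<nu>) \<nu> F"
  by (simp add: tendsto_weakly_def)

lemma tendsto_weakly_conv_power:
  fixes \<mu> :: "'b \<Rightarrow> (real ^ 'd) measure"
  assumes \<mu>: "\<And>a. a \<in> D \<Longrightarrow> prob_space (\<mu> a)" "\<And>a. a \<in> D \<Longrightarrow> sets (\<mu> a) = sets borel"
    and \<nu>: "prob_space \<nu>" "sets \<nu> = sets borel"
    and D: "\<forall>\<^sub>F a in F. a \<in> D" and lim: "tendsto_weakly \<mu> \<nu> F"
  shows "tendsto_weakly (\<lambda>a. conv_power k (\<mu> a)) (conv_power k \<nu>) F"
proof (induction k)
  case 0
  show ?case by (simp add: tendsto_weakly_const)
next
  case (Suc k)
  show ?case
    unfolding conv_power.simps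
    by (rule tendsto_weakly_convolution[where D = D])
      (simp_all add: prob_space_conv_power assms Suc)
qed

lemma integral_scale_down:
  fixes \<rho> :: "(real ^ 'd) measure" and \<phi> :: "real ^ 'd \<Rightarrow> real"
  assumes [measurable_cong]: "sets \<rho> = sets borel" and [measurable]: "\<phi> \<in> borel_measurable borel"
  shows "(\<integral>x. \<phi> x \<partial>scale_down K \<rho>) = (\<integral>x. \<phi> (x /\<^sub>R real K) \<partial>\<rho>)"
  unfolding scale_down_def by (rule integral_distr) simp_all

lemma tendsto_weakly_scale_down:
  fixes \<mu> :: "'b \<Rightarrow> (real ^ 'd) measure"
  assumes \<mu>: "\<And>a. a \<in> D \<Longrightarrow> sets (\<mu> a) = sets borel" and \<nu>: "sets \<nu> = sets borel"
    and D: "\<forall>\<^sub>F a in F. a \<in> D" and lim: "tendsto_weakly \<mu> \<nu> F"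
  shows "tendsto_weakly (\<lambda>a. scale_down K (\<mu> a)) (scale_down K \<nu>) F"
proof (rule tendsto_weaklyI)
  fix \<phi> :: "real ^ 'd \<Rightarrow> real" and B
  assume \<phi>: "continuous_on UNIV \<phi>" and B: "\<And>x. \<bar>\<phi> x\<bar> \<le> B"
  have [measurable]: "\<phi> \<in> borel_measurable borel"
    using \<phi> by (rule borel_measurable_continuous_onI)
  have "continuous_on UNIV (\<lambda>x. \<phi> (x /\<^sub>R real K))"
    by (rule continuous_on_compose2[OF \<phi>]) (auto intro!: continuous_intros)
  from tendsto_weaklyD[OF lim this B]
  show "((\<lambda>a. \<integral>x. \<phi> x \<partial>scale_down K (\<mu> a)) \<longlongrightarrow> (\<integral>x. \<phi> x \<partial>scale_down K \<nu>)) F"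
    unfolding integral_scale_down[OF \<nu> \<open>\<phi> \<in> borel_measurable borel\<close>]
  proof (rule Lim_transform_eventually)
    show "\<forall>\<^sub>F a in F. (\<integral>x. \<phi> (x /\<^sub>R real K) \<partial>\<mu> a) = (\<integral>x. \<phi> x \<partial>scale_down K (\<mu> a))"
      using D by eventually_elim (simp add: integral_scale_down \<mu>)
  qed
qed

lemma sets_gaussian [simp]: "sets (gaussian \<sigma>) = sets borel"
  by (simp add: gaussian_def)

lemma sets_scale_down [simp]: "sets (scale_down K \<rho>) = sets borel"
  by (simp add: scale_down_def)

lemma prob_space_scale_down:
  assumes "prob_space \<rho>" and [measurable_cong]: "sets \<rho> = sets borel"
  shows "prob_space (scale_down K \<rho>)"
  unfolding scale_down_def by (rule prob_space.prob_space_distr[OF assms(1)]) simp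

lemma tendsto_weakly_averaging_operator:
  fixes \<mu> :: "'b \<Rightarrow> (real ^ 'd) measure"
  assumes "\<sigma> > 0"
    and \<mu>: "\<And>a. a \<in> D \<Longrightarrow> prob_space (\<mu> a)" "\<And>a. a \<in> D \<Longrightarrow> sets (\<mu> a) = sets borel"
    and \<nu>: "prob_space \<nu>" "sets \<nu> = sets borel"
    and D: "\<forall>\<^sub>F a in F. a \<in> D" and lim: "tendsto_weakly \<mu> \<nu> F"
  shows "tendsto_weakly (\<lambda>a. averaging_operator K \<sigma> (\<mu> a)) (averaging_operator K \<sigma> \<nu>) F"
  unfolding averaging_operator_def
proof (rule tendsto_weakly_convolution[where D = D])
  show "tendsto_weakly (\<lambda>a. scale_down K (conv_power K (\<mu> a))) (scale_down K (conv_power K \<nu>)) F"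
    by (rule tendsto_weakly_scale_down[where D = D])
      (simp_all add: assms tendsto_weakly_conv_power[OF \<mu> \<nu> D lim])
qed (simp_all add: prob_space_scale_down prob_space_conv_power prob_space_gaussian tendsto_weakly_const assms)

section \<open>Convergence in probability as convergence along a filter\<close>

text \<open>
  The samples where \<open>P\<close> fails need not form a measurable set, and \<open>measure\<close> would assign the meaningless value
  \<open>0\<close> to such a set; hence they are only covered by measurable events \<open>A N\<close> of small probability.
\<close>

definition high_probability :: "(nat \<Rightarrow> 'a measure) \<Rightarrow> (nat \<times> 'a) filter" where
  "high_probability M = Abs_filter (\<lambda>P. \<exists>A. (\<lambda>N. measure (M N) (A N)) \<longlonglongrightarrow> 0 \<and>
     (\<forall>\<^sub>F N in sequentially. A N \<in> sets (M N) \<and> (\<forall>\<omega>\<in>space (M N) - A N. P (N, \<omega>))))"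

lemma eventually_high_probability:
  "eventually P (high_probability M) \<longleftrightarrow> (\<exists>A. (\<lambda>N. measure (M N) (A N)) \<longlonglongrightarrow> 0 \<and>
     (\<forall>\<^sub>F N in sequentially. A N \<in> sets (M N) \<and> (\<forall>\<omega>\<in>space (M N) - A N. P (N, \<omega>))))"
  unfolding high_probability_def
proof (rule eventually_Abs_filter, rule is_filter.intro, goal_cases)
  case 1
  show ?case by (intro exI[of _ "\<lambda>_. {}"]) auto
next
  case (2 P Q)
  then obtain A B where
    A: "(\<lambda>N. measure (M N) (A N)) \<longlonglongrightarrow> 0"
      "\<forall>\<^sub>F N in sequentially. A N \<in> sets (M N) \<and> (\<forall>\<omega>\<in>space (M N) - A N. P (N, \<omega>))" and
    B: "(\<lambda>N. measure (M N) (B N)) \<longlonglongrightarrow> 0"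
      "\<forall>\<^sub>F N in sequentially. B N \<in> sets (M N) \<and> (\<forall>\<omega>\<in>space (M N) - B N. Q (N, \<omega>))"
    by blast
  have "(\<lambda>N. measure (M N) (A N \<union> B N)) \<longlonglongrightarrow> 0"
  proof (rule tendsto_sandwich[OF _ _ tendsto_const])
    show "\<forall>\<^sub>F N in sequentially. measure (M N) (A N \<union> B N) \<le> measure (M N) (A N) + measure (M N) (B N)"
      using A(2) B(2) by eventually_elim (auto intro: measure_Un_le)
    show "(\<lambda>N. measure (M N) (A N) + measure (M N) (B N)) \<longlonglongrightarrow> 0"
      using tendsto_add[OF A(1) B(1)] by simp
  qed simp
  moreover have "\<forall>\<^sub>F N in sequentially. A N \<union> B N \<in> sets (M N) \<and>
      (\<forall>\<omega>\<in>space (M N) - (A N \<union> B N). P (N, \<omega>) \<and> Q (N, \<omega>))"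
    using A(2) B(2) by eventually_elim auto
  ultimately show ?case by (intro exI[of _ "\<lambda>N. A N \<union> B N"] conjI)
next
  case (3 P Q)
  then obtain A where A: "(\<lambda>N. measure (M N) (A N)) \<longlonglongrightarrow> 0"
      "\<forall>\<^sub>F N in sequentially. A N \<in> sets (M N) \<and> (\<forall>\<omega>\<in>space (M N) - A N. P (N, \<omega>))"
    by blast
  from A(2) 3(1) have "\<forall>\<^sub>F N in sequentially. A N \<in> sets (M N) \<and> (\<forall>\<omega>\<in>space (M N) - A N. Q (N, \<omega>))"
    by (auto elim!: eventually_mono)
  with A(1) show ?case by blast
qed

lemma eventually_high_probability_sequentially:
  assumes "\<forall>\<^sub>F N in sequentially. \<forall>\<omega>\<in>space (M N). P (N, \<omega>)"
  shows "eventually P (high_probability M)"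
  unfolding eventually_high_probability
  by (intro exI[of _ "\<lambda>_. {}"]) (use assms in \<open>auto elim!: eventually_mono\<close>)

text \<open>
  This turns the limit calculus for filters (sums, sandwiching, finite intersections of eventual properties)
  into a calculus for convergence in probability.
\<close>

lemma tendsto_in_prob_iff_high_probability:
  assumes fin: "\<forall>\<^sub>F N in sequentially. prob_space (M N) \<and> Z N \<in> borel_measurable (M N)"
  shows "tendsto_in_prob M Z c \<longleftrightarrow> ((\<lambda>(N, \<omega>). Z N \<omega>) \<longlongrightarrow> c) (high_probability M)"
proof
  assume *: "tendsto_in_prob M Z c"
  show "((\<lambda>(N, \<omega>). Z N \<omega>) \<longlongrightarrow> c) (high_probability M)"
  proof (rule tendstoI)
    fix e :: real assume "e > 0"
    \<comment> \<open>Off the event for \<open>e\<close> itself one only gets a distance \<open>\<le> e\<close>, whereas \<open>tendstoI\<close> asks for \<open>< e\<close>.\<close>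
    let ?A = "\<lambda>N. {\<omega> \<in> space (M N). e / 2 < \<bar>Z N \<omega> - c\<bar>}"
    have "(\<lambda>N. measure (M N) (?A N)) \<longlonglongrightarrow> 0"
      using * \<open>e > 0\<close> unfolding tendsto_in_prob_def by (meson half_gt_zero)
    moreover have "\<forall>\<^sub>F N in sequentially. ?A N \<in> sets (M N) \<and>
        (\<forall>\<omega>\<in>space (M N) - ?A N. dist (case (N, \<omega>) of (N, \<omega>) \<Rightarrow> Z N \<omega>) c < e)"
      using fin
    proof eventually_elim
      case (elim N)
      then have [measurable]: "Z N \<in> borel_measurable (M N)" by simp
      have "?A N \<in> sets (M N)" by measurable
      with \<open>e > 0\<close> show ?case by (auto simp: dist_real_def)
    qed
    ultimately show "\<forall>\<^sub>F p in high_probability M. dist (case p of (N, \<omega>) \<Rightarrow> Z N \<omega>) c < e"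
      unfolding eventually_high_probability by (intro exI[of _ ?A] conjI)
  qed
next
  assume *: "((\<lambda>(N, \<omega>). Z N \<omega>) \<longlongrightarrow> c) (high_probability M)"
  show "tendsto_in_prob M Z c"
    unfolding tendsto_in_prob_def
  proof (intro allI impI)
    fix e :: real assume "e > 0"
    from tendstoD[OF * this] obtain A where A: "(\<lambda>N. measure (M N) (A N)) \<longlonglongrightarrow> 0"
      "\<forall>\<^sub>F N in sequentially. A N \<in> sets (M N) \<and> (\<forall>\<omega>\<in>space (M N) - A N. dist (Z N \<omega>) c < e)"
      unfolding eventually_high_probability by auto
    show "(\<lambda>N. measure (M N) {\<omega> \<in> space (M N). e < \<bar>Z N \<omega> - c\<bar>}) \<longlonglongrightarrow> 0"
    proof (rule tendsto_sandwich[OF _ _ tendsto_const A(1)])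
      show "\<forall>\<^sub>F N in sequentially. measure (M N) {\<omega> \<in> space (M N). e < \<bar>Z N \<omega> - c\<bar>} \<le> measure (M N) (A N)"
        using A(2) fin
      proof eventually_elim
        case (elim N)
        then interpret prob_space "M N" by simp
        have "{\<omega> \<in> space (M N). e < \<bar>Z N \<omega> - c\<bar>} \<subseteq> A N"
        proof safe
          fix \<omega> assume "\<omega> \<in> space (M N)" "e < \<bar>Z N \<omega> - c\<bar>"
          then show "\<omega> \<in> A N" using elim(1) by (auto simp: dist_real_def not_less[symmetric] dest!: bspec[of _ _ \<omega>])
        qed
        then show ?case by (rule finite_measure_mono) (use elim in auto)
      qed
    qed simp
  qed
qed

lemma tendsto_in_prob_of_second_moment:
  fixes Z :: "nat \<Rightarrow> 'a \<Rightarrow> real"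
  assumes fin: "\<forall>\<^sub>F N in sequentially. prob_space (M N) \<and> Z N \<in> borel_measurable (M N) \<and>
      integrable (M N) (\<lambda>\<omega>. (Z N \<omega>)\<^sup>2) \<and> (\<integral>\<omega>. (Z N \<omega>)\<^sup>2 \<partial>M N) \<le> b N"
    and b: "b \<longlonglongrightarrow> 0"
  shows "tendsto_in_prob M Z 0"
  unfolding tendsto_in_prob_def
proof (intro allI impI)
  fix e :: real assume e: "e > 0"
  show "(\<lambda>N. measure (M N) {\<omega> \<in> space (M N). e < \<bar>Z N \<omega> - 0\<bar>}) \<longlonglongrightarrow> 0"
  proof (rule tendsto_sandwich[OF _ _ tendsto_const])
    show "(\<lambda>N. b N / e\<^sup>2) \<longlonglongrightarrow> 0"
      using tendsto_divide[OF b tendsto_const[of "e\<^sup>2"]] e by simp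
    show "\<forall>\<^sub>F N in sequentially. measure (M N) {\<omega> \<in> space (M N). e < \<bar>Z N \<omega> - 0\<bar>} \<le> b N / e\<^sup>2"
      using fin
    proof eventually_elim
      case (elim N)
      then interpret prob_space "M N" by simp
      have [measurable]: "Z N \<in> borel_measurable (M N)" using elim by simp
      have "prob {\<omega> \<in> space (M N). e < \<bar>Z N \<omega> - 0\<bar>} \<le> prob {\<omega> \<in> space (M N). e\<^sup>2 \<le> (Z N \<omega>)\<^sup>2}"
      proof (rule finite_measure_mono)
        have "e\<^sup>2 \<le> z\<^sup>2" if "e < \<bar>z\<bar>" for z :: real
          using that e abs_le_square_iff[of e z] by auto
        then show "{\<omega> \<in> space (M N). e < \<bar>Z N \<omega> - 0\<bar>} \<subseteq> {\<omega> \<in> space (M N). e\<^sup>2 \<le> (Z N \<omega>)\<^sup>2}" by auto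
      qed measurable
      also have "\<dots> \<le> (\<integral>\<omega>. (Z N \<omega>)\<^sup>2 \<partial>M N) / e\<^sup>2"
        by (rule integral_Markov_inequality_measure[where A = "{}"]) (use elim e in auto)
      also have "\<dots> \<le> b N / e\<^sup>2"
        using elim by (intro divide_right_mono) auto
      finally show ?case .
    qed
  qed simp
qed

section \<open>Freezing independent variables and empirical measures\<close>

text \<open>
  Reading the empirical measure as the law of a uniformly chosen particle is what links the random indices
  of the model to the averaging operator.
\<close>

lemma empirical_measure_eq_distr:
  assumes "N \<ge> 1"
  shows "empirical_measure N c = distr (uniform_count_measure {1..N}) borel c"
proof (rule measure_eqI)
  fix A assume "A \<in> sets (empirical_measure N c)"
  then have A: "A \<in> sets borel" by simp
  have "emeasure (empirical_measure N c) A = ennreal (1 / real N) * of_nat (card (c -` A \<inter> {1..N}))"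
    using A by (simp add: emeasure_empirical_measure indicator_def of_bool_def sum.If_cases vimage_def Int_commute)
  also have "\<dots> = ennreal (real (card (c -` A \<inter> {1..N})) / real N)"
    by (simp add: ennreal_of_nat_eq_real_of_nat ennreal_mult[symmetric])
  also have "\<dots> = emeasure (distr (uniform_count_measure {1..N}) borel c) A"
    using A assms
    by (subst emeasure_distr)
      (simp_all add: emeasure_uniform_count_measure space_uniform_count_measure
        measurable_cong_sets[OF sets_uniform_count_measure_count_space refl])
  finally show "emeasure (empirical_measure N c) A = emeasure (distr (uniform_count_measure {1..N}) borel c) A" .
qed simp

lemma prob_space_empirical_measure:
  "N \<ge> 1 \<Longrightarrow> prob_space (empirical_measure N c)"
  unfolding empirical_measure_eq_distr
  by (rule prob_space.prob_space_distr[OF prob_space_uniform_count_measure])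
    (simp_all add: measurable_cong_sets[OF sets_uniform_count_measure_count_space refl])

lemma integral_empirical_measure:
  fixes \<phi> :: "real ^ 'd \<Rightarrow> real"
  assumes "N \<ge> 1" "\<phi> \<in> borel_measurable borel"
  shows "(\<integral>x. \<phi> x \<partial>empirical_measure N c) = (\<Sum>i = 1..N. \<phi> (c i)) / real N"
  unfolding empirical_measure_eq_distr[OF assms(1)]
  by (subst integral_distr)
    (simp_all add: assms integral_uniform_count_measure measurable_cong_sets[OF sets_uniform_count_measure_count_space refl])

text \<open>
  A form of Fubini's theorem for independent \<open>\<sigma>\<close>-algebras, which avoids conditional expectations: independence
  says that \<open>\<omega> \<mapsto> (\<omega>, \<omega>)\<close> maps \<open>M\<close> to the product of its restrictions to \<open>F\<close> and \<open>G\<close>, so in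
  \<open>h \<omega> \<omega>\<close> the \<open>F\<close>-measurable argument can be frozen while the \<open>G\<close>-measurable one is averaged.  Working with
  \<open>\<omega>\<close> itself spares the bookkeeping of random variables with values in different spaces.
\<close>

lemma (in prob_space) expectation_freezing:
  fixes h :: "'a \<Rightarrow> 'a \<Rightarrow> real"
  assumes F: "space F = space M" "sets F \<subseteq> events" and G: "space G = space M" "sets G \<subseteq> events"
    and indep: "indep_set (sets F) (sets G)"
    and h: "(\<lambda>(\<omega>, \<omega>'). h \<omega> \<omega>') \<in> borel_measurable (F \<Otimes>\<^sub>M G)" "\<And>\<omega> \<omega>'. \<bar>h \<omega> \<omega>'\<bar> \<le> B"
  shows "expectation (\<lambda>\<omega>. h \<omega> \<omega>) = expectation (\<lambda>\<omega>. expectation (\<lambda>\<omega>'. h \<omega> \<omega>'))"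
    and "(\<lambda>\<omega>. expectation (\<lambda>\<omega>'. h \<omega> \<omega>')) \<in> borel_measurable F"
proof -
  have product: "emeasure M (A \<inter> C) = emeasure M A * emeasure M C" if "A \<in> sets F" "C \<in> sets G" for A C
    using indep_setD[OF indep that] by (simp add: emeasure_eq_measure ennreal_mult)
  have idF: "(\<lambda>\<omega>. \<omega>) \<in> M \<rightarrow>\<^sub>M F" and idG: "(\<lambda>\<omega>. \<omega>) \<in> M \<rightarrow>\<^sub>M G"
    using F G by (auto intro!: measurableI simp: sets.Int_space_eq2 dest: sets.sets_into_space)
  define F' where "F' = distr M F (\<lambda>\<omega>. \<omega>)"
  define G' where "G' = distr M G (\<lambda>\<omega>. \<omega>)"
  have [measurable_cong, simp]: "sets F' = sets F" "sets G' = sets G"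
    by (simp_all add: F'_def G'_def)
  interpret F': prob_space F' unfolding F'_def by (rule prob_space_distr[OF idF])
  interpret G': prob_space G' unfolding G'_def by (rule prob_space_distr[OF idG])
  interpret pair_prob_space F' G' ..
  have eF: "emeasure F' A = emeasure M A" if "A \<in> sets F" for A
    using that F sets.sets_into_space[OF that] by (simp add: F'_def emeasure_distr[OF idF] Int_absorb2)
  have eG: "emeasure G' A = emeasure M A" if "A \<in> sets G" for A
    using that G sets.sets_into_space[OF that] by (simp add: G'_def emeasure_distr[OF idG] Int_absorb2)
  have pair: "(\<lambda>\<omega>. (\<omega>, \<omega>)) \<in> M \<rightarrow>\<^sub>M F \<Otimes>\<^sub>M G"
    using idF idG by (rule measurable_Pair)
  have joint: "F' \<Otimes>\<^sub>M G' = distr M (F \<Otimes>\<^sub>M G) (\<lambda>\<omega>. (\<omega>, \<omega>))"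
  proof (rule pair_measure_eqI)
    fix A C assume "A \<in> sets F'" "C \<in> sets G'"
    then have A: "A \<in> sets F" and C: "C \<in> sets G" by simp_all
    have "emeasure (distr M (F \<Otimes>\<^sub>M G) (\<lambda>\<omega>. (\<omega>, \<omega>))) (A \<times> C) = emeasure M (A \<inter> C)"
      using A C sets.sets_into_space[OF A] F
      by (subst emeasure_distr[OF pair]) (auto intro!: arg_cong[where f = "emeasure M"])
    also have "\<dots> = emeasure F' A * emeasure G' C"
      using A C by (simp add: eF eG product)
    finally show "emeasure F' A * emeasure G' C = emeasure (distr M (F \<Otimes>\<^sub>M G) (\<lambda>\<omega>. (\<omega>, \<omega>))) (A \<times> C)" ..
  qed (unfold_locales, simp_all)
  have inner: "(\<integral>\<omega>'. h \<omega> \<omega>' \<partial>G') = (\<integral>\<omega>'. h \<omega> \<omega>' \<partial>M)" if "\<omega> \<in> space M" for \<omega>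
    unfolding G'_def using measurable_compose[OF measurable_Pair1'[of \<omega> F G] h(1)] that F
    by (intro integral_distr[OF idG]) auto
  have h': "(\<lambda>(\<omega>, \<omega>'). h \<omega> \<omega>') \<in> borel_measurable (F \<Otimes>\<^sub>M G')"
    using h(1) by measurable
  have m: "(\<lambda>\<omega>. \<integral>\<omega>'. h \<omega> \<omega>' \<partial>G') \<in> borel_measurable F"
    by (rule G'.borel_measurable_lebesgue_integral[OF h'])
  then show mF: "(\<lambda>\<omega>. (\<integral>\<omega>'. h \<omega> \<omega>' \<partial>M)) \<in> borel_measurable F"
    by (subst (asm) measurable_cong) (auto simp: inner F)
  have "(\<integral>\<omega>. h \<omega> \<omega> \<partial>M) = (\<integral>p. h (fst p) (snd p) \<partial>(F' \<Otimes>\<^sub>M G'))"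
    unfolding joint using h(1) by (subst integral_distr[OF pair]) (simp_all add: case_prod_beta')
  also have "\<dots> = (\<integral>\<omega>. \<integral>\<omega>'. h \<omega> \<omega>' \<partial>G' \<partial>F')"
  proof (subst integral_fst'[symmetric])
    show "integrable (F' \<Otimes>\<^sub>M G') (\<lambda>p. h (fst p) (snd p))"
    proof (rule P.integrable_const_bound[where B = B])
      show "(\<lambda>p. h (fst p) (snd p)) \<in> borel_measurable (F' \<Otimes>\<^sub>M G')"
        using h(1) by (simp add: case_prod_beta' cong: measurable_cong_sets)
    qed (use h(2) in auto)
  qed simp
  also have "\<dots> = (\<integral>\<omega>. \<integral>\<omega>'. h \<omega> \<omega>' \<partial>G' \<partial>M)"
    unfolding F'_def using m by (rule integral_distr[OF idF])
  also have "\<dots> = (\<integral>\<omega>. \<integral>\<omega>'. h \<omega> \<omega>' \<partial>M \<partial>M)"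
    by (rule Bochner_Integration.integral_cong) (auto simp: inner)
  finally show "(\<integral>\<omega>. h \<omega> \<omega> \<partial>M) = (\<integral>\<omega>. \<integral>\<omega>'. h \<omega> \<omega>' \<partial>M \<partial>M)" .
qed


section \<open>One step of the particle system\<close>

context K_averaging_model
begin

text \<open>
  The \<open>\<sigma>\<close>-algebra generated by the sources in \<open>Q\<close>, as a measure space so that dependence on these sources only
  can be written as measurability with respect to \<open>info Q\<close>.
\<close>

definition info :: "source set \<Rightarrow> 'a measure" where
  "info Q = sigma (space M) (\<Union>s\<in>Q. source_algebra M N X S W s)"

lemma source_algebra_subset_Pow: "source_algebra M N X S W s \<subseteq> Pow (space M)"
  by (cases s) (use sets.space_closed in \<open>force+\<close>)

lemma space_info [simp]: "space (info Q) = space M"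
  by (simp add: info_def space_measure_of_conv)

lemma sets_info: "sets (info Q) = sigma_sets (space M) (\<Union>s\<in>Q. source_algebra M N X S W s)"
  unfolding info_def using source_algebra_subset_Pow by (intro sets_measure_of) blast

lemma sets_info_subset_events:
  assumes "Q \<subseteq> sources N K"
  shows "sets (info Q) \<subseteq> events"
  unfolding sets_info
  using assms independent by (intro sets.sigma_sets_subset) (auto simp: indep_sets_def)

lemma Int_stable_source_algebra: "Int_stable (source_algebra M N X S W s)"
  by (cases s) (simp_all only: source_algebra.simps sets.Int_stable)

lemma indep_set_info:
  assumes "Q \<subseteq> sources N K" "R \<subseteq> sources N K" "Q \<inter> R = {}"
  shows "indep_set (sets (info Q)) (sets (info R))"
proof -
  have "indep_sets (\<lambda>b. sigma_sets (space M) (\<Union>s\<in>case_bool Q R b. source_algebra M N X S W s)) UNIV"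
  proof (rule indep_sets_collect_sigma)
    show "indep_sets (source_algebra M N X S W) (\<Union>b. case_bool Q R b)"
      using assms by (intro indep_sets_mono_index[OF _ independent]) (auto split: bool.splits)
    show "disjoint_family (case_bool Q R)"
      using assms by (auto simp: disjoint_family_on_def split: bool.splits)
  qed (rule Int_stable_source_algebra)
  also have "(\<lambda>b. sigma_sets (space M) (\<Union>s\<in>case_bool Q R b. source_algebra M N X S W s)) =
      case_bool (sets (info Q)) (sets (info R))"
    by (auto simp: sets_info fun_eq_iff split: bool.split)
  finally show ?thesis unfolding indep_set_def .
qed

lemma indep_var_info:
  assumes "Q \<subseteq> sources N K" "R \<subseteq> sources N K" "Q \<inter> R = {}"
    and Y: "Y \<in> info Q \<rightarrow>\<^sub>M L" and Z: "Z \<in> info R \<rightarrow>\<^sub>M L'"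
  shows "indep_var L Y L' Z"
  unfolding indep_var_eq
proof (intro conjI)
  show "random_variable L Y" "random_variable L' Z"
    using Y Z sets_info_subset_events[OF assms(1)] sets_info_subset_events[OF assms(2)]
    by (auto simp: measurable_def)
  have "sigma_sets (space M) {Y -` A \<inter> space M |A. A \<in> sets L} \<subseteq> sets (info Q)"
    using sets.sigma_sets_subset[of "{Y -` A \<inter> space M |A. A \<in> sets L}" "info Q"] measurable_sets[OF Y] by auto
  moreover have "sigma_sets (space M) {Z -` A \<inter> space M |A. A \<in> sets L'} \<subseteq> sets (info R)"
    using sets.sigma_sets_subset[of "{Z -` A \<inter> space M |A. A \<in> sets L'}" "info R"] measurable_sets[OF Z] by auto
  ultimately show "indep_set (sigma_sets (space M) {Y -` A \<inter> space M |A. A \<in> sets L})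
      (sigma_sets (space M) {Z -` A \<inter> space M |A. A \<in> sets L'})"
    using indep_set_info[OF assms(1-3)] unfolding indep_sets2_eq by blast
qed

lemma measurable_info:
  assumes "s \<in> Q" "source_algebra M N X S W s = sets (vimage_algebra (space M) f L)" "f \<in> space M \<rightarrow> space L"
  shows "f \<in> info Q \<rightarrow>\<^sub>M L"
proof (rule measurableI)
  fix A assume "A \<in> sets L"
  then have "f -` A \<inter> space M \<in> source_algebra M N X S W s"
    unfolding assms(2) by (rule in_vimage_algebra)
  then show "f -` A \<inter> space (info Q) \<in> sets (info Q)"
    using assms(1) by (auto simp: sets_info)
qed (use assms(3) in auto)

lemma measurable_info_initial:
  assumes "Initial \<in> Q" "i \<in> {1..N}"
  shows "X 0 i \<in> info Q \<rightarrow>\<^sub>M borel"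
proof -
  have "(\<lambda>\<omega>. \<lambda>i\<in>{1..N}. X 0 i \<omega>) \<in> info Q \<rightarrow>\<^sub>M (\<Pi>\<^sub>M i\<in>{1..N}. borel)"
    by (rule measurable_info[OF assms(1)]) (auto simp: space_PiM)
  from measurable_compose[OF this measurable_component_singleton[OF assms(2)]] show ?thesis
    using assms(2) by simp
qed

lemma measurable_info_index:
  assumes "Index n i j \<in> Q" "i \<in> {1..N}" "j \<in> {1..K}"
  shows "S n i j \<in> info Q \<rightarrow>\<^sub>M count_space {1..N}"
  by (rule measurable_info[OF assms(1)]) (use measurable_space[OF index_rv[OF assms(2,3)]] in auto)

lemma measurable_info_noise:
  assumes "Noise n i \<in> Q" "i \<in> {1..N}"
  shows "W n i \<in> info Q \<rightarrow>\<^sub>M borel"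
  by (rule measurable_info[OF assms(1)]) auto

definition past :: "nat \<Rightarrow> source set" where
  "past n = {Initial} \<union> {Index m i j | m i j. m < n \<and> i \<in> {1..N} \<and> j \<in> {1..K}}
     \<union> {Noise m i | m i. m < n \<and> i \<in> {1..N}}"

definition fresh :: "nat \<Rightarrow> nat \<Rightarrow> source set" where
  "fresh n i = {Index n i j | j. j \<in> {1..K}} \<union> {Noise n i}"

lemma past_subset_sources: "past n \<subseteq> sources N K"
  by (auto simp: past_def sources_def)

lemma fresh_subset_sources: "i \<in> {1..N} \<Longrightarrow> fresh n i \<subseteq> sources N K"
  by (auto simp: fresh_def sources_def)

lemma past_Int_fresh: "past n \<inter> fresh n i = {}"
  by (auto simp: past_def fresh_def)

lemma fresh_Int_fresh: "i \<noteq> l \<Longrightarrow> fresh n i \<inter> fresh n l = {}"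
  by (auto simp: fresh_def)

text \<open>
  The position reached by particle \<open>i\<close> when the configuration at time \<open>n\<close> is taken from the sample \<open>\<omega>\<close> and
  the indices and the noise from the sample \<open>\<omega>'\<close>.  Separating the two samples allows freezing the configuration.
\<close>

definition next_position :: "nat \<Rightarrow> nat \<Rightarrow> 'a \<Rightarrow> 'a \<Rightarrow> real ^ 'd" where
  "next_position n i \<omega> \<omega>' = (1 / real K) *\<^sub>R (\<Sum>j = 1..K. X n (S n i j \<omega>') \<omega>) + W n i \<omega>'"

lemma measurable_next_position:
  assumes X: "\<And>l. l \<in> {1..N} \<Longrightarrow> X n l \<in> F \<rightarrow>\<^sub>M borel" and i: "i \<in> {1..N}" and R: "fresh n i \<subseteq> R"
  shows "(\<lambda>(\<omega>, \<omega>'). next_position n i \<omega> \<omega>') \<in> borel_measurable (F \<Otimes>\<^sub>M info R)"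
proof -
  have "(\<lambda>p. X n (S n i j (snd p)) (fst p)) \<in> borel_measurable (F \<Otimes>\<^sub>M info R)" if j: "j \<in> {1..K}" for j
  proof (rule measurable_compose_countable'[where I = "{1..N}"])
    show "(\<lambda>p. X n l (fst p)) \<in> borel_measurable (F \<Otimes>\<^sub>M info R)" if "l \<in> {1..N}" for l
      using measurable_compose[OF measurable_fst X[OF that]] .
    have "Index n i j \<in> R" using R j by (auto simp: fresh_def)
    from measurable_compose[OF measurable_snd measurable_info_index[OF this i j]]
    show "(\<lambda>p. S n i j (snd p)) \<in> F \<Otimes>\<^sub>M info R \<rightarrow>\<^sub>M count_space {1..N}" .
  qed simp
  moreover have "Noise n i \<in> R" using R by (auto simp: fresh_def)
  from measurable_compose[OF measurable_snd measurable_info_noise[OF this i]]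
  have "(\<lambda>p. W n i (snd p)) \<in> borel_measurable (F \<Otimes>\<^sub>M info R)" .
  ultimately show ?thesis
    unfolding next_position_def case_prod_beta'
    by (intro borel_measurable_add borel_measurable_scaleR borel_measurable_sum) auto
qed

lemma step_eq_next_position:
  "i \<in> {1..N} \<Longrightarrow> \<omega> \<in> space M \<Longrightarrow> X (Suc n) i \<omega> = next_position n i \<omega> \<omega>"
  by (simp add: step next_position_def)

lemma measurable_position_Suc:
  assumes X: "\<And>l. l \<in> {1..N} \<Longrightarrow> X n l \<in> info Q \<rightarrow>\<^sub>M borel" and i: "i \<in> {1..N}" and Q: "fresh n i \<subseteq> Q"
  shows "X (Suc n) i \<in> info Q \<rightarrow>\<^sub>M borel"
proof -
  have "(\<lambda>\<omega>. (\<omega>, \<omega>)) \<in> info Q \<rightarrow>\<^sub>M info Q \<Otimes>\<^sub>M info Q"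
    by (intro measurable_Pair) auto
  from measurable_compose[OF this measurable_next_position[OF X i Q]]
  have "(\<lambda>\<omega>. next_position n i \<omega> \<omega>) \<in> info Q \<rightarrow>\<^sub>M borel" by simp
  then show ?thesis
    by (subst measurable_cong) (auto simp: step_eq_next_position[OF i])
qed

lemma measurable_position_past:
  "past n \<subseteq> Q \<Longrightarrow> i \<in> {1..N} \<Longrightarrow> X n i \<in> info Q \<rightarrow>\<^sub>M borel"
proof (induction n arbitrary: i)
  case 0
  then show ?case by (intro measurable_info_initial) (auto simp: past_def)
next
  case (Suc n)
  have "past n \<subseteq> past (Suc n)" "fresh n i \<subseteq> past (Suc n)"
    using Suc.prems(2) by (auto simp: past_def fresh_def)
  with Suc show ?case by (intro measurable_position_Suc) auto
qed

text \<open>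
  For a fixed configuration \<open>c\<close>, the chosen positions are independent samples of the empirical measure of \<open>c\<close>,
  and the law of a sum of independent variables is the convolution of their laws.
\<close>

lemma distr_index_sum:
  assumes i: "i \<in> {1..N}" and "k \<le> K"
  shows "distr M borel (\<lambda>\<omega>. \<Sum>j = 1..k. c (S n i j \<omega>)) = conv_power k (empirical_measure N c)"
  using \<open>k \<le> K\<close>
proof (induction k)
  case 0
  show ?case by (simp add: distr_const)
next
  case (Suc k)
  let ?Q = "{Index n i (Suc k)}" and ?R = "{Index n i j | j. j \<in> {1..k}}"
  have N: "N \<ge> 1" using i by auto
  have Q: "?Q \<subseteq> sources N K" and R: "?R \<subseteq> sources N K"
    using i Suc.prems by (auto simp: sources_def)
  have c: "c \<in> count_space {1..N} \<rightarrow>\<^sub>M borel" by simp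
  have mQ: "(\<lambda>\<omega>. c (S n i (Suc k) \<omega>)) \<in> info ?Q \<rightarrow>\<^sub>M borel"
    by (rule measurable_compose[OF measurable_info_index c]) (use i Suc.prems in auto)
  have mR: "(\<lambda>\<omega>. \<Sum>j = 1..k. c (S n i j \<omega>)) \<in> info ?R \<rightarrow>\<^sub>M borel"
    by (rule borel_measurable_sum, rule measurable_compose[OF measurable_info_index c]) (use i Suc.prems in auto)
  have indep: "indep_var borel (\<lambda>\<omega>. c (S n i (Suc k) \<omega>)) borel (\<lambda>\<omega>. \<Sum>j = 1..k. c (S n i j \<omega>))"
    by (rule indep_var_info[OF Q R _ mQ mR]) auto
  have "distr M borel (\<lambda>\<omega>. c (S n i (Suc k) \<omega>)) = distr (distr M (count_space {1..N}) (S n i (Suc k))) borel c"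
    using index_rv[OF i, of "Suc k" n] Suc.prems by (simp add: distr_distr comp_def)
  also have "\<dots> = empirical_measure N c"
    using Suc.prems by (subst index_law[OF i]) (simp_all add: empirical_measure_eq_distr[OF N])
  finally have law: "distr M borel (\<lambda>\<omega>. c (S n i (Suc k) \<omega>)) = empirical_measure N c" .
  have "distr M borel (\<lambda>\<omega>. \<Sum>j = 1..Suc k. c (S n i j \<omega>)) =
      distr M borel (\<lambda>\<omega>. c (S n i (Suc k) \<omega>) + (\<Sum>j = 1..k. c (S n i j \<omega>)))"
    by (simp add: add.commute)
  also have "\<dots> = (distr M borel (\<lambda>\<omega>. c (S n i (Suc k) \<omega>)) \<star> distr M borel (\<lambda>\<omega>. \<Sum>j = 1..k. c (S n i j \<omega>)))"
    using indep by (intro sum_indep_random_variable) (auto simp: indep_var_eq)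
  finally show ?case
    using Suc by (simp add: law)
qed

text \<open>
  The operator \<open>T\<close> enters here: it gives the conditional law of each next position given the current configuration.
\<close>

lemma distr_next_position:
  assumes i: "i \<in> {1..N}"
  shows "distr M borel (next_position n i \<omega>) = averaging_operator K \<sigma> (empirical_measure N (\<lambda>l. X n l \<omega>))"
proof -
  let ?c = "\<lambda>l. X n l \<omega>"
  let ?Q = "{Noise n i}" and ?R = "{Index n i j | j. j \<in> {1..K}}"
  let ?T = "\<lambda>\<omega>'. \<Sum>j = 1..K. ?c (S n i j \<omega>')"
  have Q: "?Q \<subseteq> sources N K" and R: "?R \<subseteq> sources N K"
    using i by (auto simp: sources_def)
  have c: "?c \<in> count_space {1..N} \<rightarrow>\<^sub>M borel" by simp
  have T: "?T \<in> info ?R \<rightarrow>\<^sub>M borel"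
    by (rule borel_measurable_sum, rule measurable_compose[OF measurable_info_index c]) (use i in auto)
  then have T': "(\<lambda>\<omega>'. ?T \<omega>' /\<^sub>R real K) \<in> info ?R \<rightarrow>\<^sub>M borel" by simp
  have TM: "random_variable borel ?T"
    using T sets_info_subset_events[OF R] by (auto simp: measurable_def)
  have indep: "indep_var borel (W n i) borel (\<lambda>\<omega>'. ?T \<omega>' /\<^sub>R real K)"
    by (rule indep_var_info[OF Q R _ measurable_info_noise T']) (use i in auto)
  have "distr M borel (next_position n i \<omega>) = distr M borel (\<lambda>\<omega>'. W n i \<omega>' + ?T \<omega>' /\<^sub>R real K)"
    by (rule distr_cong) (auto simp: next_position_def add.commute divide_inverse)
  also have "\<dots> = (distr M borel (W n i) \<star> distr M borel (\<lambda>\<omega>'. ?T \<omega>' /\<^sub>R real K))"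
    using indep by (intro sum_indep_random_variable) (auto simp: indep_var_eq)
  also have "distr M borel (\<lambda>\<omega>'. ?T \<omega>' /\<^sub>R real K) = scale_down K (distr M borel ?T)"
    unfolding scale_down_def using TM by (simp add: distr_distr comp_def)
  finally show ?thesis
    by (simp only: noise_law[OF i] distr_index_sum[OF i order_refl, where c = ?c] averaging_operator_def)
qed

lemma measurable_info_mono:
  assumes "f \<in> info Q \<rightarrow>\<^sub>M L" "Q \<subseteq> R"
  shows "f \<in> info R \<rightarrow>\<^sub>M L"
proof -
  have "sets (info Q) \<subseteq> sets (info R)"
    unfolding sets_info using assms(2) by (intro sigma_sets_mono') blast
  with assms(1) show ?thesis by (auto simp: measurable_def)
qed

lemma random_variable_info:
  assumes "f \<in> info Q \<rightarrow>\<^sub>M L" "Q \<subseteq> sources N K"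
  shows "random_variable L f"
  using assms(1) sets_info_subset_events[OF assms(2)] by (auto simp: measurable_def)

lemma integral_averaging_operator_empirical_measure:
  fixes \<phi> :: "real ^ 'd \<Rightarrow> real"
  assumes i: "i \<in> {1..N}" and \<omega>: "\<omega> \<in> space M" and \<phi>: "\<phi> \<in> borel_measurable borel"
  shows "(\<integral>x. \<phi> x \<partial>averaging_operator K \<sigma> (empirical_measure N (\<lambda>l. X n l \<omega>))) =
    expectation (\<lambda>\<omega>'. \<phi> (next_position n i \<omega> \<omega>'))"
proof -
  have "(\<lambda>(\<omega>, \<omega>'). next_position n i \<omega> \<omega>') \<in> borel_measurable (info (past n) \<Otimes>\<^sub>M info (fresh n i))"
    using i by (intro measurable_next_position measurable_position_past) auto
  from measurable_compose[OF measurable_Pair1'[of \<omega>] this] \<omega>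
  have "next_position n i \<omega> \<in> info (fresh n i) \<rightarrow>\<^sub>M borel" by simp
  from random_variable_info[OF this fresh_subset_sources[OF i]] show ?thesis
    unfolding distr_next_position[OF i, symmetric] using \<phi> by (rule integral_distr)
qed

text \<open>
  \<open>A\<close> is the conditional mean of \<open>\<phi> (X (Suc n) i)\<close> given the configuration at time \<open>n\<close>, and \<open>Z\<close> is the mean of the
  centred variables \<open>d i = \<phi> (X (Suc n) i) - A\<close>.  For \<open>i \<noteq> l\<close> these are orthogonal: \<open>d i\<close> and \<open>A\<close> depend on
  the past and the choices of particle \<open>i\<close> only, and freezing those and averaging over the fresh choices of particle \<open>l\<close>
  turns \<open>d l\<close> into \<open>A - A\<close>.  So only the \<open>N\<close> diagonal terms contribute to the second moment.
\<close>

lemma second_moment_empirical_measure_Suc: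
  fixes \<phi> :: "real ^ 'd \<Rightarrow> real" and n :: nat
  assumes N: "N \<ge> 1" and \<sigma>: "\<sigma> > 0"
    and \<phi> [measurable]: "\<phi> \<in> borel_measurable borel" and B: "\<And>x. \<bar>\<phi> x\<bar> \<le> B"
  defines "A \<equiv> \<lambda>\<omega>. \<integral>x. \<phi> x \<partial>averaging_operator K \<sigma> (empirical_measure N (\<lambda>l. X n l \<omega>))"
  defines "Z \<equiv> \<lambda>\<omega>. (\<integral>x. \<phi> x \<partial>empirical_measure N (\<lambda>i. X (Suc n) i \<omega>)) - A \<omega>"
  shows "random_variable borel Z" "integrable M (\<lambda>\<omega>. (Z \<omega>)\<^sup>2)"
    and "expectation (\<lambda>\<omega>. (Z \<omega>)\<^sup>2) \<le> (2 * B)\<^sup>2 / real N"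
proof -
  have A_eq: "A \<omega> = expectation (\<lambda>\<omega>'. \<phi> (next_position n i \<omega> \<omega>'))" if "i \<in> {1..N}" "\<omega> \<in> space M" for i \<omega>
    unfolding A_def using that \<phi> by (rule integral_averaging_operator_empirical_measure)
  have A_bound: "\<bar>A \<omega>\<bar> \<le> B" for \<omega>
    unfolding A_def using N \<sigma>
    by (intro abs_integral_le prob_space_averaging_operator prob_space_empirical_measure B) auto
  have \<phi>_next: "(\<lambda>(\<omega>, \<omega>'). \<phi> (next_position n i \<omega> \<omega>')) \<in> borel_measurable (info Q \<Otimes>\<^sub>M info (fresh n i))"
    if "i \<in> {1..N}" "past n \<subseteq> Q" for i Q
    using measurable_compose[OF measurable_next_position[OF measurable_position_past[OF that(2)] that(1) order_refl] \<phi>]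
    by (simp add: case_prod_beta')
  have mA: "A \<in> borel_measurable (info (past n))"
  proof -
    \<comment> \<open>\<open>A\<close> is an integral over a measure that depends on the configuration; its measurability
      is inherited from the averaged form, for which any particle serves.\<close>
    have 1: "1 \<in> {1..N}" using N by simp
    have "(\<lambda>\<omega>. expectation (\<lambda>\<omega>'. \<phi> (next_position n 1 \<omega> \<omega>'))) \<in> borel_measurable (info (past n))"
      by (rule expectation_freezing(2)[OF _ _ _ _ indep_set_info \<phi>_next B])
        (use 1 past_Int_fresh past_subset_sources fresh_subset_sources[OF 1] sets_info_subset_events in auto)
    then show ?thesis
      by (subst measurable_cong) (auto simp: A_eq[OF 1])
  qed
  define d where "d = (\<lambda>i \<omega>. \<phi> (X (Suc n) i \<omega>) - A \<omega>)"
  let ?Q = "\<lambda>i. past n \<union> fresh n i"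
  have Q: "?Q i \<subseteq> sources N K" if "i \<in> {1..N}" for i
    using past_subset_sources fresh_subset_sources[OF that] by auto
  have mAQ [measurable]: "A \<in> borel_measurable (info (?Q i))" for i
    using mA by (rule measurable_info_mono) auto
  have md [measurable]: "d i \<in> borel_measurable (info (?Q i))" if "i \<in> {1..N}" for i
  proof -
    have [measurable]: "X (Suc n) i \<in> info (?Q i) \<rightarrow>\<^sub>M borel"
      using that by (intro measurable_position_Suc measurable_position_past) auto
    show ?thesis unfolding d_def by measurable
  qed
  have d_rv [measurable]: "random_variable borel (d i)" if "i \<in> {1..N}" for i
    using md[OF that] Q[OF that] by (rule random_variable_info)
  have d_bound: "\<bar>d i \<omega>\<bar> \<le> 2 * B" for i \<omega>
    unfolding d_def using B[of "X (Suc n) i \<omega>"] A_bound[of \<omega>] by linarith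
  have dd_bound: "\<bar>d i \<omega> * d l \<omega>\<bar> \<le> (2 * B)\<^sup>2" for i l \<omega>
    unfolding abs_mult power2_eq_square by (intro mult_mono d_bound) (use d_bound[of i \<omega>] in auto)
  have dd_int: "integrable M (\<lambda>\<omega>. d i \<omega> * d l \<omega>)" if "i \<in> {1..N}" "l \<in> {1..N}" for i l
    using dd_bound d_rv[OF that(1)] d_rv[OF that(2)]
    by (intro integrable_const_bound[where B = "(2 * B)\<^sup>2"]) auto
  have cross: "expectation (\<lambda>\<omega>. d i \<omega> * d l \<omega>) = 0" if i: "i \<in> {1..N}" and l: "l \<in> {1..N}" and "i \<noteq> l" for i l
  proof -
    define h where "h = (\<lambda>\<omega> \<omega>'. d i \<omega> * (\<phi> (next_position n l \<omega> \<omega>') - A \<omega>))"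
    have "expectation (\<lambda>\<omega>. d i \<omega> * d l \<omega>) = expectation (\<lambda>\<omega>. h \<omega> \<omega>)"
      by (rule Bochner_Integration.integral_cong) (auto simp: h_def d_def step_eq_next_position[OF l])
    also have "\<dots> = expectation (\<lambda>\<omega>. expectation (\<lambda>\<omega>'. h \<omega> \<omega>'))"
    proof (rule expectation_freezing(1))
      show "indep_set (sets (info (?Q i))) (sets (info (fresh n l)))"
        using Q[OF i] fresh_subset_sources[OF l] past_Int_fresh fresh_Int_fresh[OF \<open>i \<noteq> l\<close>]
        by (intro indep_set_info) (auto simp: Int_Un_distrib2)
      have "(\<lambda>p. \<phi> (next_position n l (fst p) (snd p))) \<in> borel_measurable (info (?Q i) \<Otimes>\<^sub>M info (fresh n l))"
        using \<phi>_next[OF l, of "?Q i"] by (simp add: case_prod_beta')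
      moreover have "(\<lambda>p. d i (fst p)) \<in> borel_measurable (info (?Q i) \<Otimes>\<^sub>M info (fresh n l))"
        "(\<lambda>p. A (fst p)) \<in> borel_measurable (info (?Q i) \<Otimes>\<^sub>M info (fresh n l))"
        using measurable_compose[OF measurable_fst md[OF i]] measurable_compose[OF measurable_fst mAQ] by auto
      ultimately show "(\<lambda>(\<omega>, \<omega>'). h \<omega> \<omega>') \<in> borel_measurable (info (?Q i) \<Otimes>\<^sub>M info (fresh n l))"
        unfolding h_def case_prod_beta' by (intro borel_measurable_times borel_measurable_diff)
      show "\<bar>h \<omega> \<omega>'\<bar> \<le> (2 * B) * (2 * B)" for \<omega> \<omega>'
        unfolding h_def abs_mult
        using d_bound[of i \<omega>] B[of "next_position n l \<omega> \<omega>'"] A_bound[of \<omega>] by (intro mult_mono) auto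
    qed (use Q[OF i] fresh_subset_sources[OF l] sets_info_subset_events in auto)
    also have "\<dots> = expectation (\<lambda>\<omega>. 0)"
    proof (rule Bochner_Integration.integral_cong[OF refl])
      fix \<omega> assume \<omega>: "\<omega> \<in> space M"
      have "(\<lambda>\<omega>'. \<phi> (next_position n l \<omega> \<omega>')) \<in> borel_measurable (info (fresh n l))"
        using measurable_compose[OF measurable_Pair1'[of \<omega>] \<phi>_next[OF l order_refl]] \<omega> by simp
      then have "random_variable borel (\<lambda>\<omega>'. \<phi> (next_position n l \<omega> \<omega>'))"
        by (rule random_variable_info[OF _ fresh_subset_sources[OF l]])
      then have "integrable M (\<lambda>\<omega>'. \<phi> (next_position n l \<omega> \<omega>'))"
        using B by (intro integrable_const_bound[where B = B]) auto
      then show "expectation (\<lambda>\<omega>'. h \<omega> \<omega>') = 0"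
        using A_eq[OF l \<omega>] by (simp add: h_def prob_space)
    qed
    finally show ?thesis by simp
  qed
  have Z_eq: "Z = (\<lambda>\<omega>. (\<Sum>i = 1..N. d i \<omega>) / real N)"
    using N by (auto simp: Z_def d_def integral_empirical_measure sum_subtractf diff_divide_distrib)
  have Z2_eq: "(Z \<omega>)\<^sup>2 = (\<Sum>i = 1..N. \<Sum>l = 1..N. d i \<omega> * d l \<omega>) / (real N)\<^sup>2" for \<omega>
    by (simp add: Z_eq power_divide power2_eq_square[of "sum _ _"] sum_product)
  show "random_variable borel Z"
    unfolding Z_eq using d_rv by (intro borel_measurable_divide borel_measurable_sum) auto
  show "integrable M (\<lambda>\<omega>. (Z \<omega>)\<^sup>2)"
    unfolding Z2_eq using dd_int by (intro integrable_divide_zero Bochner_Integration.integrable_sum) auto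
  have "expectation (\<lambda>\<omega>. (Z \<omega>)\<^sup>2) = (\<Sum>i = 1..N. \<Sum>l = 1..N. expectation (\<lambda>\<omega>. d i \<omega> * d l \<omega>)) / (real N)\<^sup>2"
  proof -
    have "expectation (\<lambda>\<omega>. \<Sum>i = 1..N. \<Sum>l = 1..N. d i \<omega> * d l \<omega>) =
        (\<Sum>i = 1..N. expectation (\<lambda>\<omega>. \<Sum>l = 1..N. d i \<omega> * d l \<omega>))"
      by (intro Bochner_Integration.integral_sum Bochner_Integration.integrable_sum dd_int)
    also have "\<dots> = (\<Sum>i = 1..N. \<Sum>l = 1..N. expectation (\<lambda>\<omega>. d i \<omega> * d l \<omega>))"
      by (intro sum.cong refl Bochner_Integration.integral_sum dd_int)
    finally show ?thesis
      unfolding Z2_eq by simp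
  qed
  also have "(\<Sum>i = 1..N. \<Sum>l = 1..N. expectation (\<lambda>\<omega>. d i \<omega> * d l \<omega>)) =
      (\<Sum>i = 1..N. expectation (\<lambda>\<omega>. d i \<omega> * d i \<omega>))"
  proof (rule sum.cong[OF refl])
    fix i assume i: "i \<in> {1..N}"
    have "(\<Sum>l = 1..N. expectation (\<lambda>\<omega>. d i \<omega> * d l \<omega>)) =
        (\<Sum>l = 1..N. if l = i then expectation (\<lambda>\<omega>. d i \<omega> * d i \<omega>) else 0)"
      by (rule sum.cong) (use i cross in auto)
    then show "(\<Sum>l = 1..N. expectation (\<lambda>\<omega>. d i \<omega> * d l \<omega>)) = expectation (\<lambda>\<omega>. d i \<omega> * d i \<omega>)"
      using i by simp
  qed
  also have "\<dots> \<le> (\<Sum>i = 1..N. (2 * B)\<^sup>2)"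
  proof (rule sum_mono)
    fix i assume i: "i \<in> {1..N}"
    show "expectation (\<lambda>\<omega>. d i \<omega> * d i \<omega>) \<le> (2 * B)\<^sup>2"
      using dd_bound[of i _ i] by (intro integral_le_const dd_int i) (auto simp: abs_le_iff)
  qed
  also have "\<dots> / (real N)\<^sup>2 = (2 * B)\<^sup>2 / real N"
    using N by (simp add: power2_eq_square)
  finally show "expectation (\<lambda>\<omega>. (Z \<omega>)\<^sup>2) \<le> (2 * B)\<^sup>2 / real N"
    by (simp add: divide_right_mono)
qed

end

section \<open>Propagation of convergence in time\<close>

lemma tendsto_weakly_in_prob_iff:
  assumes "\<forall>\<^sub>F N in sequentially. prob_space (M N) \<and>
    (\<forall>\<phi> :: real ^ 'd \<Rightarrow> real. continuous_on UNIV \<phi> \<longrightarrow> (\<lambda>\<omega>. \<integral>x. \<phi> x \<partial>\<mu> N \<omega>) \<in> borel_measurable (M N))"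
  shows "tendsto_weakly_in_prob M \<mu> \<nu> \<longleftrightarrow> tendsto_weakly (\<lambda>(N, \<omega>). \<mu> N \<omega>) \<nu> (high_probability M)"
proof -
  have "tendsto_in_prob M (\<lambda>N \<omega>. \<integral>x. \<phi> x \<partial>\<mu> N \<omega>) (\<integral>x. \<phi> x \<partial>\<nu>) \<longleftrightarrow>
      ((\<lambda>p. \<integral>x. \<phi> x \<partial>(case p of (N, \<omega>) \<Rightarrow> \<mu> N \<omega>)) \<longlongrightarrow> (\<integral>x. \<phi> x \<partial>\<nu>)) (high_probability M)"
    if "continuous_on UNIV \<phi>" for \<phi> :: "real ^ 'd \<Rightarrow> real"
    by (subst tendsto_in_prob_iff_high_probability)
      (use assms that in \<open>auto elim!: eventually_mono simp: case_prod_beta'\<close>)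
  then show ?thesis
    unfolding tendsto_weakly_in_prob_def tendsto_weakly_def by blast
qed

theorem theorem1:
  fixes K :: nat and \<sigma> :: real
    and M :: "nat \<Rightarrow> 'a measure"
    and X :: "nat \<Rightarrow> nat \<Rightarrow> nat \<Rightarrow> 'a \<Rightarrow> real ^ 'd"
    and S :: "nat \<Rightarrow> nat \<Rightarrow> nat \<Rightarrow> nat \<Rightarrow> 'a \<Rightarrow> nat"
    and W :: "nat \<Rightarrow> nat \<Rightarrow> nat \<Rightarrow> 'a \<Rightarrow> real ^ 'd"
    and \<rho> :: "nat \<Rightarrow> (real ^ 'd) measure"
    and n :: nat
  assumes "K \<ge> 2" and "\<sigma> > 0"
    and model: "\<And>N. N \<ge> 1 \<Longrightarrow> K_averaging_model (M N) K \<sigma> N (X N) (S N) (W N)"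
    and rho_0: "prob_space (\<rho> 0)" "sets (\<rho> 0) = sets borel"
    and rho_Suc: "\<And>m. \<rho> (Suc m) = averaging_operator K \<sigma> (\<rho> m)"
    and initial: "tendsto_weakly_in_prob M
      (\<lambda>N \<omega>. empirical_measure N (\<lambda>i. X N 0 i \<omega>)) (\<rho> 0)"
  shows "tendsto_weakly_in_prob M
      (\<lambda>N \<omega>. empirical_measure N (\<lambda>i. X N n i \<omega>)) (\<rho> n)"
proof -
  let ?H = "high_probability M"
  let ?emp = "\<lambda>n (N, \<omega>). empirical_measure N (\<lambda>i. X N n i \<omega>)"
  let ?D = "{1..} \<times> (UNIV :: 'a set)"
  have N: "\<forall>\<^sub>F N in sequentially. N \<ge> (1::nat)" by (rule eventually_ge_at_top)
  have D: "\<forall>\<^sub>F p in ?H. p \<in> ?D"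
    by (rule eventually_high_probability_sequentially) (rule eventually_mono[OF N], auto)
  have emp: "prob_space (?emp n p)" "sets (?emp n p) = sets borel" if "p \<in> ?D" for n p
    using that prob_space_empirical_measure by auto
  have \<rho>: "prob_space (\<rho> m)" "sets (\<rho> m) = sets borel" for m
    by (induction m) (simp_all add: rho_0 rho_Suc prob_space_averaging_operator \<open>\<sigma> > 0\<close>)
  have iff: "tendsto_weakly_in_prob M (\<lambda>N \<omega>. empirical_measure N (\<lambda>i. X N n i \<omega>)) (\<rho> n) \<longleftrightarrow>
      tendsto_weakly (?emp n) (\<rho> n) ?H" for n
  proof (rule tendsto_weakly_in_prob_iff, use N in eventually_elim)
    case (elim N)
    interpret K_averaging_model "M N" K \<sigma> N "X N" "S N" "W N" by (rule model[OF elim])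
    have "(\<lambda>\<omega>. \<integral>x. \<phi> x \<partial>empirical_measure N (\<lambda>i. X N n i \<omega>)) \<in> borel_measurable (M N)"
      if "continuous_on UNIV \<phi>" for \<phi> :: "real ^ 'd \<Rightarrow> real"
    proof -
      have \<phi>: "\<phi> \<in> borel_measurable borel" using that by (rule borel_measurable_continuous_onI)
      show ?thesis
        unfolding integral_empirical_measure[OF elim \<phi>]
        by (intro borel_measurable_divide borel_measurable_sum measurable_compose[OF random_variable_position \<phi>]) auto
    qed
    then show ?case using prob_space_axioms by blast
  qed
  have "tendsto_weakly (?emp n) (\<rho> n) ?H"
  proof (induction n)
    case 0
    show ?case using initial iff by blast
  next
    case (Suc n)
    have T: "tendsto_weakly (\<lambda>p. averaging_operator K \<sigma> (?emp n p)) (\<rho> (Suc n)) ?H"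
      unfolding rho_Suc by (rule tendsto_weakly_averaging_operator[OF \<open>\<sigma> > 0\<close> emp \<rho> D Suc])
    show ?case
    proof (rule tendsto_weaklyI)
      fix \<phi> :: "real ^ 'd \<Rightarrow> real" and B
      assume \<phi>: "continuous_on UNIV \<phi>" and B: "\<And>x. \<bar>\<phi> x\<bar> \<le> B"
      have m\<phi>: "\<phi> \<in> borel_measurable borel" using \<phi> by (rule borel_measurable_continuous_onI)
      \<comment> \<open>Split \<open>\<langle>\<mu>', \<phi>\<rangle>\<close> for the next empirical measure \<open>\<mu>'\<close> into its fluctuation around
        \<open>\<langle>T \<mu>, \<phi>\<rangle>\<close> and that quantity itself.\<close>
      define Z where "Z = (\<lambda>N \<omega>. (\<integral>x. \<phi> x \<partial>?emp (Suc n) (N, \<omega>)) - (\<integral>x. \<phi> x \<partial>averaging_operator K \<sigma> (?emp n (N, \<omega>))))"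
      have Z: "\<forall>\<^sub>F N in sequentially. prob_space (M N) \<and> Z N \<in> borel_measurable (M N) \<and>
          integrable (M N) (\<lambda>\<omega>. (Z N \<omega>)\<^sup>2) \<and> (\<integral>\<omega>. (Z N \<omega>)\<^sup>2 \<partial>M N) \<le> (2 * B)\<^sup>2 / real N"
        using N
      proof eventually_elim
        case (elim N)
        interpret K_averaging_model "M N" K \<sigma> N "X N" "S N" "W N" by (rule model[OF elim])
        show ?case
          using second_moment_empirical_measure_Suc[OF elim \<open>\<sigma> > 0\<close> m\<phi> B, of n] prob_space_axioms
          by (simp add: Z_def)
      qed
      have "tendsto_in_prob M Z 0"
        by (rule tendsto_in_prob_of_second_moment[OF Z]) (rule lim_const_over_n)
      then have "((\<lambda>(N, \<omega>). Z N \<omega>) \<longlongrightarrow> 0) ?H"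
        by (subst (asm) tendsto_in_prob_iff_high_probability) (use Z in \<open>auto elim: eventually_mono\<close>)
      from tendsto_add[OF this tendsto_weaklyD[OF T \<phi> B]]
      show "((\<lambda>p. \<integral>x. \<phi> x \<partial>?emp (Suc n) p) \<longlongrightarrow> (\<integral>x. \<phi> x \<partial>\<rho> (Suc n))) ?H"
        by (simp add: Z_def case_prod_beta')
    qed
  qed
  then show ?thesis using iff by blast
qed

end
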